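(* Let $k\ge 2$, let $n$ be a natural number, and let $\mathcal G$ be the generic edge-colored $k$-hypergraph with $2^n$ colors. Then $\mathcal G$ has a transitive one-point extension $\mathcal G'$ which is the merge of $n$ generic even $(k+1)$-hypergraphs.
   Context: **Extensions.** Let $\mathcal M$ be a first-order structure with universe $M$. A one-point extension of $\mathcal M$ is a first-order structure $\mathcal M'$ (in any language) with universe $M\cup\{0\}$, where $0\notin M$ is a new element, such that the stabilizer $\mathrm{Aut}(\mathcal M')_0$ of $0$, acting on $M$, equals $\mathrm{Aut}(\mathcal M)$ as a permutation group on $M$. It is a transitive (one-point) extension if $\mathrm{Aut}(\mathcal M')$ acts transitively on $M\cup\{0\}$. **Generic structures and merges.** For a Fraïssé class $\mathcal F$, the generic member of $\mathcal F$ is its Fraïssé limit, i.e. the unique (up to isomorphism) countable ultrahomogeneous structure whose age is $\mathcal F$. If $\mathcal F_1,\mathcal F_2$ are Fraïssé classes with the disjoint amalgamation property in disjoint languages $\mathcal L_1,\mathcal L_2$, their merge is the class of all $(\mathcal L_1\cup\mathcal L_2)$-structures $A$ with $A|_{\mathcal L_i}\in\mathcal F_i$ for $i=1,2$; it is again a Fraïssé class with disjoint amalgamation, and its Fraïssé limit is called the merge of the Fraïssé limits of $\mathcal F_1$ and $\mathcal F_2$. The merge of $n$ structures is defined in the same way (using $n$ disjoint copies of the language when the structures share a language). **Hypergraphs.** A $k$-hyperedge relation on $G$ is a $k$-ary relation symmetric under all permutations of coordinates and failing on every tuple whose entries are not all distinct. A $k$-hypergraph is a structure $(G,R)$ with $R$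 a $k$-hyperedge relation; it is even if every set of $k+1$ points has an even number of $k$-element subsets which are hyperedges. Let $\Delta^k_G$ be the set of $k$-tuples in $G^k$ whose entries are not all distinct. An edge-colored $k$-hypergraph with $m$ colors is a structure $(G,R_1,\dots,R_m)$ where each $R_i$ is a $k$-hyperedge relation and $\{R_1,\dots,R_m\}$ is a partition of $G^k\setminus\Delta_G^k$. "Generic" in each case refers to the class of all finite structures of the given kind. *)

theory Defs
  imports
    "HOL-Combinatorics.Permutations"
    "HOL-Library.Countable_Set"
    "HOL-Library.Disjoint_Sets"
begin

text \<open>
  Everything is done for relational languages, the only ones that occur. A language consists of a
  set of relation symbols with their arities, and tuples are lists. Empty universes are allowed.
\<close>

record 'r lang =
  symb :: "'r set"
  arity :: "'r \<Rightarrow> nat"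

record ('r, 'a) struc =
  univ :: "'a set"
  rel :: "'r \<Rightarrow> 'a list set"

definition tuples :: "nat \<Rightarrow> 'a set \<Rightarrow> 'a list set" where
  "tuples k V = {xs. length xs = k \<and> set xs \<subseteq> V}"

definition is_structure :: "'r lang \<Rightarrow> ('r, 'a) struc \<Rightarrow> bool" where
  "is_structure L A \<longleftrightarrow>
     (\<forall>r\<in>symb L. rel A r \<subseteq> tuples (arity L r) (univ A)) \<and> (\<forall>r. r \<notin> symb L \<longrightarrow> rel A r = {})"

definition is_embedding ::
    "'r lang \<Rightarrow> ('r, 'a) struc \<Rightarrow> ('r, 'b) struc \<Rightarrow> ('a \<Rightarrow> 'b) \<Rightarrow> bool" where
  "is_embedding L A B f \<longleftrightarrow>
     inj_on f (univ A) \<and> f ` univ A \<subseteq> univ B \<and>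
     (\<forall>r\<in>symb L. \<forall>xs\<in>tuples (arity L r) (univ A). xs \<in> rel A r \<longleftrightarrow> map f xs \<in> rel B r)"

definition isomorphic :: "'r lang \<Rightarrow> ('r, 'a) struc \<Rightarrow> ('r, 'b) struc \<Rightarrow> bool" where
  "isomorphic L A B \<longleftrightarrow> (\<exists>f. is_embedding L A B f \<and> f ` univ A = univ B)"

definition substructure :: "('r, 'a) struc \<Rightarrow> 'a set \<Rightarrow> ('r, 'a) struc" where
  "substructure M S = \<lparr>univ = S, rel = (\<lambda>r. rel M r \<inter> lists S)\<rparr>"

text \<open>
  As \<^const>\<open>permutes\<close> includes being the identity off the given set, each permutation of the
  universe is represented by exactly one function.
\<close>

definition Aut :: "'r lang \<Rightarrow> ('r, 'a) struc \<Rightarrow> ('a \<Rightarrow> 'a) set" where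
  "Aut L M = {f. f permutes univ M \<and> is_embedding L M M f}"

definition transitive_on :: "('a \<Rightarrow> 'a) set \<Rightarrow> 'a set \<Rightarrow> bool" where
  "transitive_on F S \<longleftrightarrow> (\<forall>x\<in>S. \<forall>y\<in>S. \<exists>f\<in>F. f x = y)"


subsection \<open>One-point extensions\<close>

text \<open>
  The new point is \<^const>\<open>None\<close>, and the old universe is identified with its copy under
  \<^const>\<open>Some\<close>. The set on the left of the last equation is the stabilizer of the new point,
  viewed as a set of permutations of the old universe.
\<close>

definition one_point_extension ::
    "'r lang \<Rightarrow> ('r, 'a) struc \<Rightarrow> 's lang \<Rightarrow> ('s, 'a option) struc \<Rightarrow> bool" where
  "one_point_extension L M L' M' \<longleftrightarrow>
     is_structure L' M' \<and>
     univ M' = insert None (Some ` univ M) \<and>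
     {g. \<exists>f\<in>Aut L' M'. f None = None \<and> (\<forall>x. f (Some x) = Some (g x))} = Aut L M"

definition transitive_one_point_extension ::
    "'r lang \<Rightarrow> ('r, 'a) struc \<Rightarrow> 's lang \<Rightarrow> ('s, 'a option) struc \<Rightarrow> bool" where
  "transitive_one_point_extension L M L' M' \<longleftrightarrow>
     one_point_extension L M L' M' \<and> transitive_on (Aut L' M') (univ M')"


subsection \<open>Fraisse classes and their limits\<close>

text \<open>
  An isomorphism-closed class of finite structures is represented by its members whose universe is
  a finite set of natural numbers; up to isomorphism these are all of them.
\<close>

definition age :: "'r lang \<Rightarrow> ('r, 'a) struc \<Rightarrow> ('r, nat) struc set" where
  "age L M = {A. is_structure L A \<and> finite (univ A) \<and> (\<exists>f. is_embedding L A M f)}"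

definition hereditary :: "'r lang \<Rightarrow> ('r, nat) struc set \<Rightarrow> bool" where
  "hereditary L K \<longleftrightarrow>
     (\<forall>A\<in>K. \<forall>B :: ('r, nat) struc.
        is_structure L B \<and> (\<exists>f. is_embedding L B A f) \<longrightarrow> B \<in> K)"

definition joint_embedding :: "'r lang \<Rightarrow> ('r, nat) struc set \<Rightarrow> bool" where
  "joint_embedding L K \<longleftrightarrow>
     (\<forall>A\<in>K. \<forall>B\<in>K. \<exists>C\<in>K. (\<exists>f. is_embedding L A C f) \<and> (\<exists>g. is_embedding L B C g))"

definition amalgamation :: "'r lang \<Rightarrow> ('r, nat) struc set \<Rightarrow> bool" where
  "amalgamation L K \<longleftrightarrow>
     (\<forall>A\<in>K. \<forall>B\<^sub>1\<in>K. \<forall>B\<^sub>2\<in>K. \<forall>f\<^sub>1 f\<^sub>2.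
        is_embedding L A B\<^sub>1 f\<^sub>1 \<and> is_embedding L A B\<^sub>2 f\<^sub>2 \<longrightarrow>
        (\<exists>C\<in>K. \<exists>g\<^sub>1 g\<^sub>2. is_embedding L B\<^sub>1 C g\<^sub>1 \<and> is_embedding L B\<^sub>2 C g\<^sub>2 \<and>
           (\<forall>a\<in>univ A. g\<^sub>1 (f\<^sub>1 a) = g\<^sub>2 (f\<^sub>2 a))))"

definition disjoint_amalgamation :: "'r lang \<Rightarrow> ('r, nat) struc set \<Rightarrow> bool" where
  "disjoint_amalgamation L K \<longleftrightarrow>
     (\<forall>A\<in>K. \<forall>B\<^sub>1\<in>K. \<forall>B\<^sub>2\<in>K. \<forall>f\<^sub>1 f\<^sub>2.
        is_embedding L A B\<^sub>1 f\<^sub>1 \<and> is_embedding L A B\<^sub>2 f\<^sub>2 \<longrightarrow>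
        (\<exists>C\<in>K. \<exists>g\<^sub>1 g\<^sub>2. is_embedding L B\<^sub>1 C g\<^sub>1 \<and> is_embedding L B\<^sub>2 C g\<^sub>2 \<and>
           (\<forall>a\<in>univ A. g\<^sub>1 (f\<^sub>1 a) = g\<^sub>2 (f\<^sub>2 a)) \<and>
           g\<^sub>1 ` univ B\<^sub>1 \<inter> g\<^sub>2 ` univ B\<^sub>2 = (\<lambda>a. g\<^sub>1 (f\<^sub>1 a)) ` univ A))"

definition fraisse_class :: "'r lang \<Rightarrow> ('r, nat) struc set \<Rightarrow> bool" where
  "fraisse_class L K \<longleftrightarrow>
     K \<noteq> {} \<and> (\<forall>A\<in>K. is_structure L A \<and> finite (univ A)) \<and>
     (\<exists>C\<subseteq>K. countable C \<and> (\<forall>A\<in>K. \<exists>B\<in>C. isomorphic L A B)) \<and>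
     hereditary L K \<and> joint_embedding L K \<and> amalgamation L K"

definition ultrahomogeneous :: "'r lang \<Rightarrow> ('r, 'a) struc \<Rightarrow> bool" where
  "ultrahomogeneous L M \<longleftrightarrow>
     (\<forall>S f. S \<subseteq> univ M \<and> finite S \<and> is_embedding L (substructure M S) M f \<longrightarrow>
        (\<exists>g\<in>Aut L M. \<forall>x\<in>S. g x = f x))"

definition is_fraisse_limit :: "'r lang \<Rightarrow> ('r, nat) struc set \<Rightarrow> ('r, 'a) struc \<Rightarrow> bool" where
  "is_fraisse_limit L K M \<longleftrightarrow>
     fraisse_class L K \<and> is_structure L M \<and> countable (univ M) \<and>
     ultrahomogeneous L M \<and> age L M = K"


subsection \<open>Merges\<close>

text \<open>Tagging the symbols with the index makes the languages of the family disjoint.\<close>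

definition merge_lang :: "'i set \<Rightarrow> ('i \<Rightarrow> 'r lang) \<Rightarrow> ('i \<times> 'r) lang" where
  "merge_lang I L = \<lparr>symb = (SIGMA i:I. symb (L i)), arity = (\<lambda>(i, r). arity (L i) r)\<rparr>"

definition reduct :: "'i \<Rightarrow> ('i \<times> 'r, 'a) struc \<Rightarrow> ('r, 'a) struc" where
  "reduct i A = \<lparr>univ = univ A, rel = (\<lambda>r. rel A (i, r))\<rparr>"

text \<open>Finiteness is stated explicitly because of the empty family.\<close>

definition merge_class ::
    "'i set \<Rightarrow> ('i \<Rightarrow> 'r lang) \<Rightarrow> ('i \<Rightarrow> ('r, nat) struc set) \<Rightarrow> ('i \<times> 'r, nat) struc set" where
  "merge_class I L K =
     {A. is_structure (merge_lang I L) A \<and> finite (univ A) \<and> (\<forall>i\<in>I. reduct i A \<in> K i)}"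

definition is_merge ::
    "'i set \<Rightarrow> ('i \<Rightarrow> 'r lang) \<Rightarrow> ('i \<Rightarrow> ('r, 'a) struc) \<Rightarrow> ('i \<times> 'r, 'b) struc \<Rightarrow> bool" where
  "is_merge I L M N \<longleftrightarrow>
     (\<exists>K. (\<forall>i\<in>I. is_fraisse_limit (L i) (K i) (M i) \<and> disjoint_amalgamation (L i) (K i)) \<and>
          is_fraisse_limit (merge_lang I L) (merge_class I L K) N)"


subsection \<open>Hypergraphs\<close>

definition hyperedge_relation :: "nat \<Rightarrow> 'a set \<Rightarrow> 'a list set \<Rightarrow> bool" where
  "hyperedge_relation k V R \<longleftrightarrow>
     R \<subseteq> tuples k V \<and> (\<forall>xs\<in>R. distinct xs) \<and>
     (\<forall>xs\<in>R. \<forall>p. p permutes {..<k} \<longrightarrow> permute_list p xs \<in> R)"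

definition hypergraph_lang :: "nat \<Rightarrow> unit lang" where
  "hypergraph_lang k = \<lparr>symb = {()}, arity = (\<lambda>_. k)\<rparr>"

definition is_hypergraph :: "nat \<Rightarrow> (unit, 'a) struc \<Rightarrow> bool" where
  "is_hypergraph k A \<longleftrightarrow>
     is_structure (hypergraph_lang k) A \<and> hyperedge_relation k (univ A) (rel A ())"

definition is_even_hypergraph :: "nat \<Rightarrow> (unit, 'a) struc \<Rightarrow> bool" where
  "is_even_hypergraph k A \<longleftrightarrow>
     is_hypergraph k A \<and>
     (\<forall>S\<subseteq>univ A. finite S \<and> card S = k + 1 \<longrightarrow>
        even (card {e. e \<subseteq> S \<and> card e = k \<and> (\<exists>xs\<in>rel A (). set xs = e)}))"

definition even_hypergraph_class :: "nat \<Rightarrow> (unit, nat) struc set" where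
  "even_hypergraph_class k = {A. is_even_hypergraph k A \<and> finite (univ A)}"

definition generic_even_hypergraph :: "nat \<Rightarrow> (unit, 'a) struc \<Rightarrow> bool" where
  "generic_even_hypergraph k A \<longleftrightarrow>
     is_fraisse_limit (hypergraph_lang k) (even_hypergraph_class k) A"

definition colored_lang :: "nat \<Rightarrow> nat \<Rightarrow> nat lang" where
  "colored_lang k m = \<lparr>symb = {..<m}, arity = (\<lambda>_. k)\<rparr>"

text \<open>
  The colors are numbered from 0. A color may be unused, as must happen in small finite structures,
  so the parts of the partition are allowed to be empty.
\<close>

definition is_colored_hypergraph :: "nat \<Rightarrow> nat \<Rightarrow> (nat, 'a) struc \<Rightarrow> bool" where
  "is_colored_hypergraph k m A \<longleftrightarrow>
     is_structure (colored_lang k m) A \<and>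
     (\<forall>i<m. hyperedge_relation k (univ A) (rel A i)) \<and>
     disjoint_family_on (rel A) {..<m} \<and>
     (\<Union>i<m. rel A i) = {xs \<in> tuples k (univ A). distinct xs}"

definition colored_hypergraph_class :: "nat \<Rightarrow> nat \<Rightarrow> (nat, nat) struc set" where
  "colored_hypergraph_class k m = {A. is_colored_hypergraph k m A \<and> finite (univ A)}"

definition generic_colored_hypergraph :: "nat \<Rightarrow> nat \<Rightarrow> (nat, 'a) struc \<Rightarrow> bool" where
  "generic_colored_hypergraph k m A \<longleftrightarrow>
     is_fraisse_limit (colored_lang k m) (colored_hypergraph_class k m) A"

end

theory Submission
  imports Defs "HOL-Library.Ramsey" "HOL-Library.Z2"
begin

text \<open>
  The even \<open>(k + 1)\<close>-hypergraphs are the \<open>(k + 1)\<close>-cocycles over the field with two elements, and on a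
  cone every cocycle is the coboundary of a unique \<open>k\<close>-cochain that vanishes on the sets containing
  the cone point. Reading a color below \<open>2\<^sup>n\<close> as \<open>n\<close> bits, a coloring of the \<open>k\<close>-subsets of \<open>V\<close> is
  therefore the same as \<open>n\<close> even hypergraphs on the cone over \<open>V\<close>, and this correspondence turns the
  stabilizer of the cone point into the automorphism group of the coloring. A type over a finite set
  of points containing the cone point is a type over the remaining points in the coloring, so the
  extension property of the generic coloring passes to the cone. By back and forth the cone is
  then the Fraisse limit of the \<open>n\<close>-tuples of even hypergraphs, and each of its \<open>n\<close> reducts is the
  Fraisse limit of the even hypergraphs. Ultrahomogeneity on single points gives transitivity.
\<close>

subsection \<open>Embeddings and copies on the natural numbers\<close>

text \<open>Two demands shape the argument. A merge is defined only for classes with disjoint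
  amalgamation, so new points must be found outside any prescribed finite set; this avoidance is
  carried from the coloring to the cone and returns as disjointness of amalgams. And the merge as
  well as each of its factors has to be recognized as a Fraisse limit; families of cocycles indexed
  by an arbitrary set of symbols cover both, provided that different symbols use different bits. A
  type at a new point \<open>v\<close> splits into free and forced data. If the cone point is among
  the old points, the edges through \<open>v\<close> and the cone point carry the bits of the colors
  and are free, which accounts for \<open>2 ^ n\<close> colors. The edges through \<open>v\<close>
  that miss the cone point are forced, by the parity condition on the set obtained by adding the
  cone point. If the cone point is not among the old points, the free data must be invented so that
  the forced data come out as prescribed.\<close>

lemma univ_substructure [simp]: "univ (substructure M S) = S"
  by (simp add: substructure_def)

lemma is_embedding_substructure:
  "is_embedding L (substructure M S) N f \<longleftrightarrow>
     inj_on f S \<and> f ` S \<subseteq> univ N \<and>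
     (\<forall>r\<in>symb L. \<forall>xs\<in>tuples (arity L r) S. xs \<in> rel M r \<longleftrightarrow> map f xs \<in> rel N r)"
proof -
  have "xs \<in> lists S" if "xs \<in> tuples k S" for xs k
    using that by (auto simp: tuples_def)
  then show ?thesis
    by (auto simp: is_embedding_def substructure_def)
qed

lemma substructure_univ:
  "is_embedding L (substructure B (univ B)) N f \<longleftrightarrow> is_embedding L B N f"
  by (subst is_embedding_substructure) (simp add: is_embedding_def)

lemma substructure_substructure: "S \<subseteq> T \<Longrightarrow> substructure (substructure B T) S = substructure B S"
  by (auto simp: substructure_def fun_eq_iff)

lemma is_embedding_cong:
  assumes "\<And>x. x \<in> univ A \<Longrightarrow> f x = g x"
  shows "is_embedding L A B f \<longleftrightarrow> is_embedding L A B g"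
proof -
  have "map f xs = map g xs" if "xs \<in> tuples k (univ A)" for xs k
    using that assms by (auto simp: tuples_def)
  then show ?thesis
    using assms by (simp add: is_embedding_def cong: inj_on_cong image_cong ball_cong del: map_eq_conv)
qed

lemma is_embedding_comp:
  assumes f: "is_embedding L A B f" and g: "is_embedding L B C g"
  shows "is_embedding L A C (g \<circ> f)"
proof -
  have "map f xs \<in> tuples k (univ B)" if "xs \<in> tuples k (univ A)" for xs k
    using that f by (auto simp: tuples_def is_embedding_def)
  moreover have "inj_on (g \<circ> f) (univ A)"
    using f g by (auto simp: is_embedding_def intro: comp_inj_on inj_on_subset)
  moreover have "(g \<circ> f) ` univ A \<subseteq> univ C"
    using f g by (fastforce simp: is_embedding_def)
  ultimately show ?thesis
    using f g by (auto simp: is_embedding_def)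
qed

lemma is_embedding_restrict:
  assumes "is_embedding L B M f" "S \<subseteq> univ B"
  shows "is_embedding L (substructure B S) M f"
  using assms unfolding is_embedding_substructure
  by (auto simp: is_embedding_def tuples_def intro: inj_on_subset)

text \<open>As \<open>e\<close> preserves and reflects relations, they can be compared in
  \<open>M\<close>. This carries configurations found inside \<open>M\<close> back to members of the
  class.\<close>

lemma is_embedding_factor:
  assumes f: "is_embedding L A M f" and e: "is_embedding L C M e" and sub: "f ` univ A \<subseteq> e ` univ C"
  shows "is_embedding L A C (inv_into (univ C) e \<circ> f)"
proof -
  let ?h = "inv_into (univ C) e \<circ> f"
  have eh: "e (?h x) = f x" if "x \<in> univ A" for x
    using sub that f_inv_into_f[of "f x" e "univ C"] by auto
  have hC: "?h x \<in> univ C" if "x \<in> univ A" for x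
    using sub that by (auto intro!: inv_into_into)
  have "inj_on ?h (univ A)"
    using f eh unfolding is_embedding_def inj_on_def by metis
  moreover have "xs \<in> rel A r \<longleftrightarrow> map ?h xs \<in> rel C r"
    if "r \<in> symb L" "xs \<in> tuples (arity L r) (univ A)" for r xs
  proof -
    have "map e (map ?h xs) = map f xs" "map ?h xs \<in> tuples (arity L r) (univ C)"
      using that eh hC by (auto simp: tuples_def)
    then show ?thesis
      using e f that unfolding is_embedding_def by metis
  qed
  ultimately show ?thesis
    using hC by (auto simp: is_embedding_def)
qed

text \<open>Members of an age live on natural numbers, so a finite part of \<open>M\<close> is
  renumbered by an injection \<open>h\<close> and read back through its inverse
  \<open>e\<close>.\<close>

lemma finite_copy:
  fixes M :: "('r, 'a) struc"
  assumes M: "is_structure L M" and S: "finite S" "S \<subseteq> univ M"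
  obtains B e where "B \<in> age L M" "is_embedding L B M e" "e ` univ B = S"
proof -
  obtain h :: "'a \<Rightarrow> nat" where h: "inj_on h S"
    using finite_imp_inj_to_nat_seg[OF S(1)] by metis
  define e where "e = inv_into S h"
  define B where "B = \<lparr>univ = h ` S, rel = (\<lambda>r. map h ` (rel M r \<inter> lists S))\<rparr>"
  have e: "e (h x) = x" if "x \<in> S" for x
    using h that by (simp add: e_def)
  have meh: "map e (map h xs) = xs" if "set xs \<subseteq> S" for xs
    using that e by (auto simp: o_def intro!: map_idI)
  have "is_structure L B"
    unfolding is_structure_def
  proof (intro conjI ballI allI impI)
    show "rel B r \<subseteq> tuples (arity L r) (univ B)" if "r \<in> symb L" for r
    proof
      fix xs assume "xs \<in> rel B r"
      then obtain ys where ys: "xs = map h ys" "ys \<in> rel M r" "set ys \<subseteq> S"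
        by (auto simp: B_def)
      then have "length ys = arity L r"
        using M that by (auto simp: is_structure_def tuples_def)
      then show "xs \<in> tuples (arity L r) (univ B)"
        using ys by (auto simp: B_def tuples_def)
    qed
    show "rel B r = {}" if "r \<notin> symb L" for r
      using M that by (simp add: is_structure_def B_def)
  qed
  moreover have emb: "is_embedding L B M e"
    unfolding is_embedding_def
  proof (intro conjI ballI)
    show "inj_on e (univ B)"
      by (auto simp: B_def inj_on_def e)
    show "e ` univ B \<subseteq> univ M"
      using S(2) by (auto simp: B_def e)
  next
    fix r xs assume "xs \<in> tuples (arity L r) (univ B)"
    then have "xs \<in> lists (h ` S)"
      by (auto simp: tuples_def B_def)
    then obtain ys where ys: "xs = map h ys" "set ys \<subseteq> S"
      by (auto simp: lists_image)
    have "map h ys \<in> map h ` (rel M r \<inter> lists S) \<longleftrightarrow> ys \<in> rel M r"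
    proof
      assume "map h ys \<in> map h ` (rel M r \<inter> lists S)"
      then obtain zs where "map h ys = map h zs" "zs \<in> rel M r" "set zs \<subseteq> S"
        by auto
      then show "ys \<in> rel M r"
        using meh ys(2) by metis
    next
      assume "ys \<in> rel M r"
      then show "map h ys \<in> map h ` (rel M r \<inter> lists S)"
        using ys(2) by blast
    qed
    then show "xs \<in> rel B r \<longleftrightarrow> map e xs \<in> rel M r"
      using meh ys by (simp add: B_def)
  qed
  moreover have "e ` univ B = S"
    by (force simp: B_def e)
  ultimately show ?thesis
    using that[of B e] S(1) by (auto simp: age_def B_def)
qed

subsection \<open>Partial isomorphisms\<close>

text \<open>Stored as a set of pairs rather than as a function: converses and unions of chains then
  need no bookkeeping of domains, and the two directions of back and forth take the same
  form.\<close>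

definition partial_iso :: "'r lang \<Rightarrow> ('r, 'a) struc \<Rightarrow> ('a \<times> 'a) set \<Rightarrow> bool" where
  "partial_iso L M p \<longleftrightarrow>
     p \<subseteq> univ M \<times> univ M \<and> (\<forall>(x, y)\<in>p. \<forall>(x', y')\<in>p. x = x' \<longleftrightarrow> y = y') \<and>
     (\<forall>r\<in>symb L. \<forall>zs\<in>tuples (arity L r) p. map fst zs \<in> rel M r \<longleftrightarrow> map snd zs \<in> rel M r)"

lemma partial_iso_converse:
  assumes "partial_iso L M p"
  shows "partial_iso L M (p\<inverse>)"
proof -
  have "map fst zs \<in> rel M r \<longleftrightarrow> map snd zs \<in> rel M r"
    if r: "r \<in> symb L" and zs: "zs \<in> tuples (arity L r) (p\<inverse>)" for r zs
  proof -
    have "map prod.swap zs \<in> tuples (arity L r) p"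
      using zs by (auto simp: tuples_def)
    then have "map fst (map prod.swap zs) \<in> rel M r \<longleftrightarrow> map snd (map prod.swap zs) \<in> rel M r"
      using assms r unfolding partial_iso_def by blast
    then show ?thesis
      by (simp add: o_def)
  qed
  then show ?thesis
    using assms unfolding partial_iso_def by fast
qed

lemma partial_iso_graph:
  assumes "S \<subseteq> univ M"
  shows "partial_iso L M ((\<lambda>x. (x, f x)) ` S) \<longleftrightarrow> is_embedding L (substructure M S) M f"
proof -
  let ?i = "\<lambda>x. (x, f x)"
  have tup: "tuples k (?i ` S) = map ?i ` tuples k S" for k
  proof
    show "tuples k (?i ` S) \<subseteq> map ?i ` tuples k S"
    proof
      fix zs assume zs: "zs \<in> tuples k (?i ` S)"
      then have "zs = map ?i (map fst zs)" "map fst zs \<in> tuples k S"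
        by (auto simp: tuples_def o_def intro!: map_idI[symmetric])
      then show "zs \<in> map ?i ` tuples k S"
        by blast
    qed
  qed (fastforce simp: tuples_def)
  show ?thesis
    using assms unfolding partial_iso_def is_embedding_substructure tup
    by (auto simp: o_def inj_on_def)
qed

lemma partial_iso_obtain:
  assumes "partial_iso L M p"
  obtains f where "p = (\<lambda>x. (x, f x)) ` fst ` p" "is_embedding L (substructure M (fst ` p)) M f"
proof -
  have "\<forall>x\<in>fst ` p. \<exists>y. (x, y) \<in> p"
    by auto
  from bchoice[OF this] obtain f where f: "\<forall>x\<in>fst ` p. (x, f x) \<in> p"
    by blast
  have "y = f x" if "(x, y) \<in> p" for x y
  proof -
    have "(x, f x) \<in> p"
      using f that by force
    then show ?thesis
      using assms that unfolding partial_iso_def by blast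
  qed
  then have "p = (\<lambda>x. (x, f x)) ` fst ` p"
    using f by force
  moreover have "fst ` p \<subseteq> univ M"
    using assms by (auto simp: partial_iso_def)
  ultimately show ?thesis
    using that partial_iso_graph[of "fst ` p" M L f] assms by metis
qed

lemma finite_subset_incseq_UN:
  fixes p :: "nat \<Rightarrow> 'a set"
  assumes "finite A" "A \<subseteq> (\<Union>n. p n)" "mono p"
  shows "\<exists>n. A \<subseteq> p n"
  using assms(1,2)
proof (induction A)
  case (insert x A)
  then obtain m n where "A \<subseteq> p m" "x \<in> p n"
    by auto
  moreover have "p m \<subseteq> p (max m n)" "p n \<subseteq> p (max m n)"
    using assms(3) by (auto simp: mono_def)
  ultimately show ?case
    by (metis insert_subset subset_trans subsetD)
qed simp

text \<open>Each condition concerns finitely many pairs, which all lie in a single member of the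
  chain.\<close>

lemma partial_iso_UN:
  assumes p: "\<And>n :: nat. partial_iso L M (p n)" and inc: "mono p"
  shows "partial_iso L M (\<Union>n. p n)"
proof -
  have fin: "\<exists>n. A \<subseteq> p n" if "finite A" "A \<subseteq> (\<Union>n. p n)" for A
    using finite_subset_incseq_UN[OF that inc] .
  have "map fst zs \<in> rel M r \<longleftrightarrow> map snd zs \<in> rel M r"
    if "r \<in> symb L" "zs \<in> tuples (arity L r) (\<Union>n. p n)" for r zs
  proof -
    have "finite (set zs)" "set zs \<subseteq> (\<Union>n. p n)"
      using that by (auto simp: tuples_def)
    from fin[OF this] obtain n where "set zs \<subseteq> p n" ..
    then show ?thesis
      using p[of n] that unfolding partial_iso_def tuples_def by blast
  qed
  moreover have "x = x' \<longleftrightarrow> y = y'" if "(x, y) \<in> (\<Union>n. p n)" "(x', y') \<in> (\<Union>n. p n)" for x y x' y'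
  proof -
    obtain n where "{(x, y), (x', y')} \<subseteq> p n"
      using fin[of "{(x, y), (x', y')}"] \<open>(x, y) \<in> _\<close> \<open>(x', y') \<in> _\<close> by auto
    then show ?thesis
      using p[of n] unfolding partial_iso_def by blast
  qed
  moreover have "(\<Union>n. p n) \<subseteq> univ M \<times> univ M"
    using p unfolding partial_iso_def by blast
  ultimately show ?thesis
    unfolding partial_iso_def by blast
qed

lemma total_partial_iso_Aut:
  assumes R: "partial_iso L M R" and tot: "fst ` R = univ M" "snd ` R = univ M"
  obtains g where "g \<in> Aut L M" "\<And>x y. (x, y) \<in> R \<Longrightarrow> g x = y"
proof -
  obtain f where f: "R = (\<lambda>x. (x, f x)) ` univ M" "is_embedding L (substructure M (univ M)) M f"
    using partial_iso_obtain[OF R] tot(1) by metis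
  \<comment> \<open>\<open>permutes\<close> asks for the identity outside the universe.\<close>
  define g where "g = (\<lambda>x. if x \<in> univ M then f x else x)"
  have emb: "is_embedding L M M f"
    using f(2) by (simp add: substructure_univ)
  have "f ` univ M = univ M"
    using tot(2) unfolding f(1) by (simp add: image_image)
  then have "bij_betw g (univ M) (univ M)"
    using emb by (simp add: bij_betw_def is_embedding_def g_def cong: inj_on_cong image_cong)
  then have "g permutes univ M"
    by (rule bij_imp_permutes) (simp add: g_def)
  moreover have "is_embedding L M M g"
    using emb is_embedding_cong[of M f g] by (simp add: g_def)
  moreover have "g x = y" if "(x, y) \<in> R" for x y
    using that f(1) by (auto simp: g_def)
  ultimately show ?thesis
    using that by (simp add: Aut_def)
qed

subsection \<open>Fraisse limits from one-point extensions of embeddings\<close>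

text \<open>The one-point form of the extension property. Avoiding the finite set \<open>X\<close>
  serves disjoint amalgamation; positive arities make the empty map an embedding, from which
  embeddings of whole structures are built up.\<close>

locale extension_property =
  fixes L :: "'r lang" and K :: "('r, nat) struc set" and M :: "('r, 'a) struc"
  assumes arity_pos: "r \<in> symb L \<Longrightarrow> arity L r > 0"
    and structure_M: "is_structure L M"
    and countable_M: "countable (univ M)"
    and K_finite: "B \<in> K \<Longrightarrow> is_structure L B \<and> finite (univ B)"
    and hereditary_K: "hereditary L K"
    and age_subset: "age L M \<subseteq> K"
    and extend_point: "B \<in> K \<Longrightarrow> b \<in> univ B \<Longrightarrow>
      is_embedding L (substructure B (univ B - {b})) M f \<Longrightarrow> finite X \<Longrightarrow>
      \<exists>v. v \<notin> X \<and> is_embedding L B M (f(b := v))"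
begin

lemma empty_embedding: "is_embedding L (substructure B {}) N f"
proof -
  have "tuples (arity L r) {} = {}" if "r \<in> symb L" for r
    using arity_pos[OF that] by (simp add: tuples_def)
  then show ?thesis
    by (auto simp: is_embedding_substructure)
qed

lemma substructure_in_K:
  assumes "B \<in> K" "S \<subseteq> univ B"
  shows "substructure B S \<in> K"
proof -
  have "is_structure L (substructure B S)"
    using K_finite[OF assms(1)] by (auto simp: is_structure_def substructure_def tuples_def)
  moreover have "is_embedding L (substructure B S) B id"
    using assms(2) by (simp add: is_embedding_substructure)
  ultimately show ?thesis
    using hereditary_K assms(1) unfolding hereditary_def by blast
qed

text \<open>Points outside \<open>A\<close> are adjoined one at a time inside induced substructures
  of \<open>B\<close>, which stay in \<open>K\<close> by heredity.\<close>

lemma extend_embedding: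
  assumes B: "B \<in> K" and A: "A \<subseteq> univ B" and f: "is_embedding L (substructure B A) M f"
    and X: "finite X"
  obtains g where "is_embedding L B M g" "\<forall>x\<in>A. g x = f x" "g ` (univ B - A) \<inter> X = {}"
proof -
  have "\<exists>g. is_embedding L (substructure B (A \<union> D)) M g \<and> (\<forall>x\<in>A. g x = f x) \<and> g ` D \<inter> X = {}"
    if "finite D" "D \<subseteq> univ B - A" for D
    using that
  proof (induction D)
    case empty
    then show ?case using f by auto
  next
    case (insert d D)
    then obtain g where g: "is_embedding L (substructure B (A \<union> D)) M g" "\<forall>x\<in>A. g x = f x"
      "g ` D \<inter> X = {}"
      by auto
    let ?B = "substructure B (A \<union> insert d D)"
    have eq: "A \<union> insert d D - {d} = A \<union> D"
      using insert by auto
    have "substructure ?B (univ ?B - {d}) = substructure B (A \<union> D)"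
      using eq by (auto intro!: substructure_substructure)
    moreover have "?B \<in> K"
      using insert A by (auto intro!: substructure_in_K B)
    ultimately obtain v where "v \<notin> X" "is_embedding L ?B M (g(d := v))"
      using extend_point[of ?B d g X] g X by auto
    moreover have "\<forall>x\<in>A. (g(d := v)) x = f x" "(g(d := v)) ` insert d D \<inter> X = {}"
      using g(2,3) \<open>v \<notin> X\<close> insert.hyps insert.prems by auto
    ultimately show ?case
      by (intro exI[of _ "g(d := v)"] conjI)
  qed
  from this[of "univ B - A"]
  have "\<exists>g. is_embedding L B M g \<and> (\<forall>x\<in>A. g x = f x) \<and> g ` (univ B - A) \<inter> X = {}"
    using K_finite[OF B] A by (simp add: Un_absorb1 substructure_univ)
  then show ?thesis
    using that by (elim exE conjE)
qed

lemma embedding_exists: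
  assumes "B \<in> K"
  shows "\<exists>g. is_embedding L B M g"
  by (rule extend_embedding[OF assms empty_subsetI empty_embedding[of B M undefined] finite.emptyI]) blast

lemma age_eq: "age L M = K"
proof
  show "K \<subseteq> age L M"
    using K_finite embedding_exists by (simp add: age_def subset_iff)
qed (fact age_subset)

lemma finite_copy_K:
  assumes "finite S" "S \<subseteq> univ M"
  obtains B e where "B \<in> K" "is_embedding L B M e" "e ` univ B = S"
  using finite_copy[OF structure_M assms] age_subset by (metis subsetD)

section \<open>Back and forth\<close>

text \<open>The extension property speaks of members of \<open>K\<close>, so the finite domain
  together with \<open>x\<close> is replaced by a copy \<open>B\<close>. The number \<open>b\<close>
  that stands for \<open>x\<close> gets its value there, and the result is read back along the
  inverse of \<open>e\<close>.\<close>

lemma forth: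
  assumes p: "partial_iso L M p" "finite p" and x: "x \<in> univ M"
  obtains q where "partial_iso L M q" "finite q" "p \<subseteq> q" "x \<in> fst ` q"
proof (cases "x \<in> fst ` p")
  case True
  then show ?thesis using p that by blast
next
  case False
  obtain f where f: "p = (\<lambda>x. (x, f x)) ` fst ` p" "is_embedding L (substructure M (fst ` p)) M f"
    using partial_iso_obtain[OF p(1)] .
  define S where "S = fst ` p"
  have S: "finite S" "S \<subseteq> univ M"
    using p by (auto simp: S_def partial_iso_def)
  obtain B e where B: "B \<in> K" "is_embedding L B M e" "e ` univ B = insert x S"
    using finite_copy_K[of "insert x S"] S x by auto
  define b where "b = inv_into (univ B) e x"
  have b: "b \<in> univ B" "e b = x"
    using B(3) by (auto simp: b_def inv_into_into f_inv_into_f)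
  have inj: "inj_on e (univ B)"
    using B(2) by (simp add: is_embedding_def)
  have eB: "e ` (univ B - {b}) = S"
    using B(3) b inj False by (auto simp: inj_on_image_set_diff S_def)
  have "is_embedding L (substructure B (univ B - {b})) (substructure M S) e"
    using is_embedding_restrict[OF B(2), of "univ B - {b}"] eB
    unfolding is_embedding_substructure by (fastforce simp: substructure_def tuples_def)
  then have "is_embedding L (substructure B (univ B - {b})) M (f \<circ> e)"
    using is_embedding_comp f(2) S_def by metis
  then obtain y where y: "is_embedding L B M ((f \<circ> e)(b := y))"
    using extend_point[OF B(1) b(1)] by blast
  have "is_embedding L (substructure M (insert x S)) B (inv_into (univ B) e \<circ> id)"
    using is_embedding_factor[OF _ B(2), of "substructure M (insert x S)" id] B(3) S x
    by (auto simp: is_embedding_substructure)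
  from is_embedding_comp[OF this y]
  have "is_embedding L (substructure M (insert x S)) M (((f \<circ> e)(b := y)) \<circ> (inv_into (univ B) e \<circ> id))" .
  also have "?this \<longleftrightarrow> is_embedding L (substructure M (insert x S)) M (f(x := y))"
  proof (rule is_embedding_cong)
    fix z assume "z \<in> univ (substructure M (insert x S))"
    then have "z \<in> e ` univ B"
      using B(3) by simp
    then show "(((f \<circ> e)(b := y)) \<circ> (inv_into (univ B) e \<circ> id)) z = (f(x := y)) z"
      using b inj by (auto simp: inj_on_eq_iff)
  qed
  finally have "partial_iso L M ((\<lambda>z. (z, (f(x := y)) z)) ` insert x S)"
    using S x by (subst partial_iso_graph) auto
  moreover have "p \<subseteq> (\<lambda>z. (z, (f(x := y)) z)) ` insert x S"
  proof
    fix z assume z: "z \<in> p"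
    then obtain w where w: "z = (w, f w)" "w \<in> S"
      using f(1) unfolding S_def by blast
    then show "z \<in> (\<lambda>z. (z, (f(x := y)) z)) ` insert x S"
      using False unfolding S_def[symmetric] by (intro image_eqI[of _ _ w]) auto
  qed
  moreover have "x \<in> fst ` (\<lambda>z. (z, (f(x := y)) z)) ` insert x S"
    by (simp add: image_image)
  ultimately show ?thesis
    using that S(1) by blast
qed

text \<open>The back step is the forth step for the converse relation.\<close>

lemma back_and_forth:
  assumes p: "partial_iso L M p" "finite p" and x: "x \<in> univ M"
  shows "\<exists>q. partial_iso L M q \<and> finite q \<and> p \<subseteq> q \<and> x \<in> fst ` q \<and> x \<in> snd ` q"
proof -
  obtain q where q: "partial_iso L M q" "finite q" "p \<subseteq> q" "x \<in> fst ` q"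
    using forth[OF assms] .
  obtain q' where q': "partial_iso L M q'" "finite q'" "q\<inverse> \<subseteq> q'" "x \<in> fst ` q'"
    using forth[OF partial_iso_converse[OF q(1)] finite_converse[THEN iffD2, OF q(2)] x] .
  have "q \<subseteq> q'\<inverse>"
    using q'(3) by auto
  moreover have "x \<in> snd ` q'\<inverse>"
    using q'(4) by force
  ultimately have "p \<subseteq> q'\<inverse>" "x \<in> fst ` q'\<inverse>" "x \<in> snd ` q'\<inverse>" "finite (q'\<inverse>)"
    using q(3,4) q'(2) by auto
  then show ?thesis
    using partial_iso_converse[OF q'(1)] by meson
qed

lemma ultrahomogeneous: "ultrahomogeneous L M"
  unfolding ultrahomogeneous_def
proof (intro allI impI; elim conjE)
  fix S f
  assume S: "S \<subseteq> univ M" "finite S" and f: "is_embedding L (substructure M S) M f"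
  show "\<exists>g\<in>Aut L M. \<forall>x\<in>S. g x = f x"
  \<comment> \<open>\<open>from_nat_into\<close> enumerates nonempty sets only.\<close>
  proof (cases "univ M = {}")
    case True
    then have "id \<in> Aut L M"
      by (simp add: Aut_def is_embedding_def permutes_id)
    then show ?thesis
      using True S by blast
  next
    case False
    let ?e = "from_nat_into (univ M)"
    let ?p = "(\<lambda>x. (x, f x)) ` S"
    have "partial_iso L M ?p" "finite ?p"
      using f S by (auto simp: partial_iso_graph)
    \<comment> \<open>Stage \<open>n\<close> puts the \<open>n\<close>-th point of the universe into
      both domain and range, so the union of the chain is total and onto.\<close>
    then have "\<exists>q. \<forall>n. (partial_iso L M (q n) \<and> finite (q n) \<and> ?p \<subseteq> q n) \<and>
      (q n \<subseteq> q (Suc n) \<and> ?e n \<in> fst ` q (Suc n) \<and> ?e n \<in> snd ` q (Suc n))"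
    proof (intro dependent_nat_choice)
      fix q n assume "partial_iso L M q \<and> finite q \<and> ?p \<subseteq> q"
      then show "\<exists>q'. (partial_iso L M q' \<and> finite q' \<and> ?p \<subseteq> q') \<and>
          (q \<subseteq> q' \<and> ?e n \<in> fst ` q' \<and> ?e n \<in> snd ` q')"
        using back_and_forth[OF _ _ from_nat_into[OF False], of q n] by (meson order_trans)
    qed blast
    then obtain q where q: "\<And>n. partial_iso L M (q n) \<and> finite (q n) \<and> ?p \<subseteq> q n"
      "\<And>n. q n \<subseteq> q (Suc n) \<and> ?e n \<in> fst ` q (Suc n) \<and> ?e n \<in> snd ` q (Suc n)"
      by blast
    let ?R = "\<Union>n. q n"
    have R: "partial_iso L M ?R"
      using q by (intro partial_iso_UN) (auto simp: mono_iff_le_Suc)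
    have "x \<in> fst ` ?R \<and> x \<in> snd ` ?R" if "x \<in> univ M" for x
    proof -
      obtain n where "x = ?e n"
        using from_nat_into_surj[OF countable_M \<open>x \<in> univ M\<close>] by blast
      then show ?thesis
        using q(2)[of n] by blast
    qed
    moreover have "?R \<subseteq> univ M \<times> univ M"
      using R by (simp add: partial_iso_def)
    ultimately have "fst ` ?R = univ M" "snd ` ?R = univ M"
      by (auto 0 3)
    then obtain g where "g \<in> Aut L M" "\<And>x y. (x, y) \<in> ?R \<Longrightarrow> g x = y"
      using total_partial_iso_Aut[OF R] by metis
    moreover have "(x, f x) \<in> ?R" if "x \<in> S" for x
      using q(1)[of 0] that by blast
    ultimately have "\<forall>x\<in>S. g x = f x"
      by simp
    then show ?thesis
      using \<open>g \<in> Aut L M\<close> ..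
  qed
qed

section \<open>Amalgamation and countability of the class\<close>

text \<open>The amalgam is formed inside \<open>M\<close>: once \<open>B\<^sub>1\<close> is
  embedded, the embedding induced on the common part is extended to \<open>B\<^sub>2\<close> so that
  the new points miss the image of \<open>B\<^sub>1\<close>. The union of the two images is finite
  and is copied as \<open>C\<close>.\<close>

lemma disjoint_amalgamation: "disjoint_amalgamation L K"
  unfolding disjoint_amalgamation_def
proof (intro ballI allI impI; elim conjE)
  fix A B\<^sub>1 B\<^sub>2 f\<^sub>1 f\<^sub>2
  assume A: "A \<in> K" and B: "B\<^sub>1 \<in> K" "B\<^sub>2 \<in> K"
    and f: "is_embedding L A B\<^sub>1 f\<^sub>1" "is_embedding L A B\<^sub>2 f\<^sub>2"
  obtain h\<^sub>1 where h\<^sub>1: "is_embedding L B\<^sub>1 M h\<^sub>1"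
    using embedding_exists[OF B(1)] by blast
  let ?A = "f\<^sub>2 ` univ A"
  let ?i = "inv_into (univ A) f\<^sub>2 \<circ> id"
  have A_sub: "?A \<subseteq> univ B\<^sub>2"
    using f(2) by (simp add: is_embedding_def)
  then have "is_embedding L (substructure B\<^sub>2 ?A) A ?i"
    by (intro is_embedding_factor[OF _ f(2)]) (auto simp: is_embedding_substructure)
  then have "is_embedding L (substructure B\<^sub>2 ?A) M (h\<^sub>1 \<circ> (f\<^sub>1 \<circ> ?i))"
    using is_embedding_comp[OF is_embedding_comp[OF _ f(1)] h\<^sub>1] by (simp add: comp_assoc)
  moreover have X: "finite (h\<^sub>1 ` univ B\<^sub>1)"
    using K_finite[OF B(1)] by simp
  ultimately obtain h\<^sub>2 where h\<^sub>2: "is_embedding L B\<^sub>2 M h\<^sub>2"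
    "\<forall>x\<in>?A. h\<^sub>2 x = (h\<^sub>1 \<circ> (f\<^sub>1 \<circ> ?i)) x" "h\<^sub>2 ` (univ B\<^sub>2 - ?A) \<inter> h\<^sub>1 ` univ B\<^sub>1 = {}"
    by (rule extend_embedding[OF B(2) A_sub])
  have "inj_on f\<^sub>2 (univ A)"
    using f(2) by (simp add: is_embedding_def)
  then have h: "h\<^sub>2 (f\<^sub>2 a) = h\<^sub>1 (f\<^sub>1 a)" if "a \<in> univ A" for a
    using h\<^sub>2(2) that by simp
  let ?S = "h\<^sub>1 ` univ B\<^sub>1 \<union> h\<^sub>2 ` univ B\<^sub>2"
  have "finite ?S" "?S \<subseteq> univ M"
    using K_finite B h\<^sub>1 h\<^sub>2(1) by (simp_all add: is_embedding_def)
  then obtain C e where C: "C \<in> K" "is_embedding L C M e" "e ` univ C = ?S"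
    by (rule finite_copy_K)
  let ?j = "inv_into (univ C) e"
  have "is_embedding L B\<^sub>1 C (?j \<circ> h\<^sub>1)" "is_embedding L B\<^sub>2 C (?j \<circ> h\<^sub>2)"
    using is_embedding_factor[OF _ C(2)] h\<^sub>1 h\<^sub>2(1) C(3) by auto
  moreover have "\<forall>a\<in>univ A. (?j \<circ> h\<^sub>1) (f\<^sub>1 a) = (?j \<circ> h\<^sub>2) (f\<^sub>2 a)"
    using h by simp
  moreover have "(?j \<circ> h\<^sub>1) ` univ B\<^sub>1 \<inter> (?j \<circ> h\<^sub>2) ` univ B\<^sub>2 = (\<lambda>a. (?j \<circ> h\<^sub>1) (f\<^sub>1 a)) ` univ A"
  proof -
    have "inj_on ?j ?S"
      using C(3) by (metis inj_on_inv_into order_refl)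
    then have "(?j \<circ> h\<^sub>1) ` univ B\<^sub>1 \<inter> (?j \<circ> h\<^sub>2) ` univ B\<^sub>2 = ?j ` (h\<^sub>1 ` univ B\<^sub>1 \<inter> h\<^sub>2 ` univ B\<^sub>2)"
      unfolding image_comp[symmetric] by (intro inj_on_image_Int[symmetric]) auto
    also have "h\<^sub>1 ` univ B\<^sub>1 \<inter> h\<^sub>2 ` univ B\<^sub>2 = (\<lambda>a. h\<^sub>1 (f\<^sub>1 a)) ` univ A"
    proof
      show "h\<^sub>1 ` univ B\<^sub>1 \<inter> h\<^sub>2 ` univ B\<^sub>2 \<subseteq> (\<lambda>a. h\<^sub>1 (f\<^sub>1 a)) ` univ A"
      proof
        fix y assume y: "y \<in> h\<^sub>1 ` univ B\<^sub>1 \<inter> h\<^sub>2 ` univ B\<^sub>2"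
        then obtain b where b: "y = h\<^sub>2 b" "b \<in> univ B\<^sub>2"
          by blast
        then have "b \<in> ?A"
          using h\<^sub>2(3) y by blast
        then show "y \<in> (\<lambda>a. h\<^sub>1 (f\<^sub>1 a)) ` univ A"
          using b(1) h by auto
      qed
      have "f\<^sub>1 a \<in> univ B\<^sub>1" if "a \<in> univ A" for a
        using f(1) that by (auto simp: is_embedding_def)
      then show "(\<lambda>a. h\<^sub>1 (f\<^sub>1 a)) ` univ A \<subseteq> h\<^sub>1 ` univ B\<^sub>1 \<inter> h\<^sub>2 ` univ B\<^sub>2"
      proof (intro image_subsetI IntI)
        fix a assume a: "a \<in> univ A"
        then show "h\<^sub>1 (f\<^sub>1 a) \<in> h\<^sub>1 ` univ B\<^sub>1"
          using \<open>a \<in> univ A \<Longrightarrow> f\<^sub>1 a \<in> univ B\<^sub>1\<close> by simp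
        show "h\<^sub>1 (f\<^sub>1 a) \<in> h\<^sub>2 ` univ B\<^sub>2"
          unfolding h[OF a, symmetric] using A_sub a by blast
      qed
    qed
    finally show ?thesis
      by (simp add: image_image)
  qed
  ultimately show "\<exists>C\<in>K. \<exists>g\<^sub>1 g\<^sub>2. is_embedding L B\<^sub>1 C g\<^sub>1 \<and> is_embedding L B\<^sub>2 C g\<^sub>2 \<and>
           (\<forall>a\<in>univ A. g\<^sub>1 (f\<^sub>1 a) = g\<^sub>2 (f\<^sub>2 a)) \<and>
           g\<^sub>1 ` univ B\<^sub>1 \<inter> g\<^sub>2 ` univ B\<^sub>2 = (\<lambda>a. g\<^sub>1 (f\<^sub>1 a)) ` univ A"
    by (intro bexI[OF _ C(1)] exI conjI)
qed

lemma amalgamation: "amalgamation L K"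
  using disjoint_amalgamation unfolding disjoint_amalgamation_def amalgamation_def by meson

text \<open>This is amalgamation over the empty structure, which embeds everywhere because arities
  are positive.\<close>

lemma joint_embedding: "joint_embedding L K"
  unfolding joint_embedding_def
proof (intro ballI)
  fix A B assume AB: "A \<in> K" "B \<in> K"
  let ?E = "substructure A {}"
  have "?E \<in> K"
    using substructure_in_K[OF AB(1)] by simp
  then show "\<exists>C\<in>K. (\<exists>f. is_embedding L A C f) \<and> (\<exists>g. is_embedding L B C g)"
    using amalgamation[unfolded amalgamation_def, rule_format, OF _ AB]
      empty_embedding[of A A] empty_embedding[of A B] by metis
qed

text \<open>One copy is chosen for each finite subset of the countable universe; a member of
  \<open>K\<close> is isomorphic to the copy chosen for the image of one of its embeddings.\<close>

lemma countable_representatives: "\<exists>C\<subseteq>K. countable C \<and> (\<forall>A\<in>K. \<exists>B\<in>C. isomorphic L A B)"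
proof -
  let ?F = "{S. finite S \<and> S \<subseteq> univ M}"
  have "\<forall>S\<in>?F. \<exists>B. B \<in> K \<and> (\<exists>e. is_embedding L B M e \<and> e ` univ B = S)"
    using finite_copy_K by (metis mem_Collect_eq)
  then obtain c where c: "\<And>S. S \<in> ?F \<Longrightarrow> c S \<in> K \<and> (\<exists>e. is_embedding L (c S) M e \<and> e ` univ (c S) = S)"
    by metis
  have "\<exists>B\<in>c ` ?F. isomorphic L A B" if A: "A \<in> K" for A
  proof -
    obtain f where f: "is_embedding L A M f"
      using embedding_exists[OF A] by blast
    then have S: "f ` univ A \<in> ?F"
      using K_finite[OF A] by (simp add: is_embedding_def)
    then obtain e where e: "is_embedding L (c (f ` univ A)) M e" "e ` univ (c (f ` univ A)) = f ` univ A"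
      using c[OF S] by (elim exE conjE)
    let ?C = "c (f ` univ A)"
    have "is_embedding L A ?C (inv_into (univ ?C) e \<circ> f)"
      using is_embedding_factor[OF f e(1)] e(2) by simp
    moreover have "(inv_into (univ ?C) e \<circ> f) ` univ A = univ ?C"
    proof -
      have "(inv_into (univ ?C) e \<circ> f) ` univ A = inv_into (univ ?C) e ` e ` univ ?C"
        by (simp add: e(2) image_comp)
      also have "\<dots> = univ ?C"
        using e(1) by (intro inv_into_image_cancel) (auto simp: is_embedding_def)
      finally show ?thesis .
    qed
    ultimately show ?thesis
      using S unfolding isomorphic_def by blast
  qed
  moreover have "countable (c ` ?F)"
    using countable_M by (simp add: countable_Collect_finite_subset)
  ultimately show ?thesis
    using c by (intro exI[of _ "c ` ?F"]) blast
qed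

theorem fraisse_limit: "is_fraisse_limit L K M"
proof -
  \<comment> \<open>The copy of the empty subset is in \<open>K\<close>, even for an empty
    \<open>M\<close>.\<close>
  have "K \<noteq> {}"
    using finite_copy_K[of "{}"] by (metis empty_iff empty_subsetI finite.emptyI)
  then have "fraisse_class L K"
    unfolding fraisse_class_def
    using K_finite countable_representatives hereditary_K joint_embedding amalgamation by blast
  then show ?thesis
    unfolding is_fraisse_limit_def
    using structure_M countable_M ultrahomogeneous age_eq by blast
qed

end

subsection \<open>Uniform hypergraphs\<close>

text \<open>Colored, even and merged hypergraphs all have one arity for all symbols, so a single set
  of lemmas serves the three languages.\<close>

abbreviation uniform_lang :: "'r set \<Rightarrow> nat \<Rightarrow> 'r lang" where
  "uniform_lang J k \<equiv> \<lparr>symb = J, arity = \<lambda>_. k\<rparr>"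

lemma hypergraph_lang_eq: "hypergraph_lang k = uniform_lang UNIV k"
  by (auto simp: hypergraph_lang_def)

lemma colored_lang_eq: "colored_lang k m = uniform_lang {..<m} k"
  by (simp add: colored_lang_def)

lemma merge_lang_eq: "merge_lang I (\<lambda>_. hypergraph_lang k) = uniform_lang (I \<times> UNIV) k"
  by (auto simp: merge_lang_def hypergraph_lang_def)

text \<open>A hyperedge relation is determined by the sets of entries of its tuples. Passing to a
  predicate \<open>E\<close> on sets makes the relations available as cochains.\<close>

definition hyper :: "'r set \<Rightarrow> nat \<Rightarrow> 'a set \<Rightarrow> ('r \<Rightarrow> 'a set \<Rightarrow> bool) \<Rightarrow> ('r, 'a) struc" where
  "hyper J k V E =
     \<lparr>univ = V, rel = \<lambda>r. if r \<in> J then {xs \<in> tuples k V. distinct xs \<and> E r (set xs)} else {}\<rparr>"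

lemma univ_hyper [simp]: "univ (hyper J k V E) = V"
  by (simp add: hyper_def)

lemma set_nsets: "xs \<in> tuples k V \<Longrightarrow> distinct xs \<Longrightarrow> set xs \<in> [V]\<^bsup>k\<^esup>"
  by (simp add: tuples_def nsets_def distinct_card)

lemma nsets_tuple:
  assumes "T \<in> [V]\<^bsup>k\<^esup>"
  obtains xs where "xs \<in> tuples k V" "distinct xs" "set xs = T"
proof -
  obtain xs where "set xs = T" "distinct xs"
    using assms finite_distinct_list by (auto simp: nsets_def)
  then show ?thesis
    using assms by (intro that[of xs]) (auto simp: nsets_def tuples_def distinct_card)
qed

lemma nsets_diff: "U \<in> [V]\<^bsup>Suc k\<^esup> \<Longrightarrow> u \<in> U \<Longrightarrow> U - {u} \<in> [V]\<^bsup>k\<^esup>"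
  by (auto simp: nsets_def)

lemma nsets_insert: "T \<in> [V]\<^bsup>k\<^esup> \<Longrightarrow> v \<in> V \<Longrightarrow> v \<notin> T \<Longrightarrow> insert v T \<in> [V]\<^bsup>Suc k\<^esup>"
  by (auto simp: nsets_def)

lemma nsets_image: "T \<in> [V]\<^bsup>k\<^esup> \<Longrightarrow> inj_on f V \<Longrightarrow> f ` T \<in> [f ` V]\<^bsup>k\<^esup>"
  by (auto simp: nsets_def card_image inj_on_subset)

lemma nsets_imageE:
  assumes "T' \<in> [f ` V]\<^bsup>k\<^esup>" "inj_on f V"
  obtains T where "T \<in> [V]\<^bsup>k\<^esup>" "T' = f ` T"
proof -
  have "T' \<subseteq> f ` V" "finite T'" "card T' = k"
    using assms(1) by (auto simp: nsets_def)
  then obtain T where T: "T \<subseteq> V" "T' = f ` T"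
    by (meson subset_imageE)
  then have "inj_on f T"
    using assms(2) inj_on_subset by blast
  then have "finite T" "card T = k"
    using T \<open>finite T'\<close> \<open>card T' = k\<close> by (auto simp: card_image finite_image_iff)
  then show ?thesis
    using that T by (simp add: nsets_def)
qed

lemma hyper_cong:
  assumes "\<And>r T. r \<in> J \<Longrightarrow> T \<in> [V]\<^bsup>k\<^esup> \<Longrightarrow> E r T \<longleftrightarrow> F r T"
  shows "hyper J k V E = hyper J k V F"
proof -
  have "{xs \<in> tuples k V. distinct xs \<and> E r (set xs)} = {xs \<in> tuples k V. distinct xs \<and> F r (set xs)}"
    if "r \<in> J" for r
    using assms[OF that] set_nsets by blast
  then show ?thesis
    by (simp add: hyper_def fun_eq_iff)
qed

lemma is_structure_hyper: "is_structure (uniform_lang J k) (hyper J k V E)"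
  by (auto simp: is_structure_def hyper_def)

lemma hyperedge_relation_hyper:
  assumes "r \<in> J"
  shows "hyperedge_relation k V (rel (hyper J k V E) r)"
proof -
  have R: "rel (hyper J k V E) r = {xs \<in> tuples k V. distinct xs \<and> E r (set xs)}"
    using assms by (simp add: hyper_def)
  have "permute_list p xs \<in> rel (hyper J k V E) r"
    if "xs \<in> rel (hyper J k V E) r" "p permutes {..<k}" for p xs
  proof -
    have "length xs = k"
      using that(1) by (simp add: R tuples_def)
    then have "p permutes {..<length xs}"
      using that(2) by simp
    then show ?thesis
      using that(1) unfolding R by (simp add: tuples_def distinct_permute_list)
  qed
  moreover have "rel (hyper J k V E) r \<subseteq> tuples k V" "\<forall>xs\<in>rel (hyper J k V E) r. distinct xs"
    unfolding R by simp_all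
  ultimately show ?thesis
    unfolding hyperedge_relation_def by simp
qed

text \<open>Two lists without repetition and with the same entries differ by a permutation, so
  symmetry recovers every tuple from its set of entries.\<close>

lemma hyper_of_relations:
  assumes "is_structure (uniform_lang J k) A"
    and hr: "\<And>r. r \<in> J \<Longrightarrow> hyperedge_relation k (univ A) (rel A r)"
  shows "A = hyper J k (univ A) (\<lambda>r T. T \<in> set ` rel A r)"
proof -
  have "rel A r = {xs \<in> tuples k (univ A). distinct xs \<and> set xs \<in> set ` rel A r}" if r: "r \<in> J" for r
  proof
    show "{xs \<in> tuples k (univ A). distinct xs \<and> set xs \<in> set ` rel A r} \<subseteq> rel A r"
    proof clarify
      fix xs ys assume xs: "xs \<in> tuples k (univ A)" "distinct xs" and ys: "ys \<in> rel A r" "set xs = set ys"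
      have ys': "ys \<in> tuples k (univ A)" "distinct ys"
        using hr[OF r] ys(1) unfolding hyperedge_relation_def by auto
      then have "mset xs = mset ys"
        using xs ys(2) by (metis mset_set_set)
      then obtain p where "p permutes {..<length ys}" "permute_list p ys = xs"
        by (rule mset_eq_permutation)
      then show "xs \<in> rel A r"
        using hr[OF r] ys(1) ys'(1) unfolding hyperedge_relation_def tuples_def by auto
    qed
    show "rel A r \<subseteq> {xs \<in> tuples k (univ A). distinct xs \<and> set xs \<in> set ` rel A r}"
      using hr[OF r] unfolding hyperedge_relation_def by blast
  qed
  moreover have "rel A r = {}" if "r \<notin> J" for r
    using assms(1) that by (simp add: is_structure_def)
  ultimately have "rel A = rel (hyper J k (univ A) (\<lambda>r T. T \<in> set ` rel A r))"
    by (auto simp: hyper_def fun_eq_iff)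
  then show ?thesis
    by (simp add: hyper_def)
qed

lemma edge_set_hyper:
  assumes "r \<in> J" "T \<in> [V]\<^bsup>k\<^esup>"
  shows "(\<exists>xs\<in>rel (hyper J k V E) r. set xs = T) \<longleftrightarrow> E r T"
proof -
  obtain xs where "xs \<in> tuples k V" "distinct xs" "set xs = T"
    using assms(2) by (rule nsets_tuple)
  then show ?thesis
    using assms(1) by (auto simp: hyper_def)
qed

lemma substructure_hyper: "S \<subseteq> V \<Longrightarrow> substructure (hyper J k V E) S = hyper J k S E"
proof -
  assume S: "S \<subseteq> V"
  have "xs \<in> tuples k V \<and> xs \<in> lists S \<longleftrightarrow> xs \<in> tuples k S" for xs
    using S by (auto simp: tuples_def)
  then have "{xs \<in> tuples k V. distinct xs \<and> E r (set xs)} \<inter> lists S =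
      {xs \<in> tuples k S. distinct xs \<and> E r (set xs)}" for r
    by blast
  then show ?thesis
    by (simp add: substructure_def hyper_def fun_eq_iff)
qed

lemma is_embedding_hyper:
  "is_embedding (uniform_lang J k) (hyper J k V E) (hyper J k W F) f \<longleftrightarrow>
     inj_on f V \<and> f ` V \<subseteq> W \<and> (\<forall>r\<in>J. \<forall>T\<in>[V]\<^bsup>k\<^esup>. E r T \<longleftrightarrow> F r (f ` T))" (is "?L \<longleftrightarrow> ?R")
proof (cases "inj_on f V \<and> f ` V \<subseteq> W")
  case True
  have tup: "map f xs \<in> tuples k W \<and> (distinct (map f xs) \<longleftrightarrow> distinct xs)" if "xs \<in> tuples k V" for xs
  proof -
    have "inj_on f (set xs)"
      using that True inj_on_subset[of f V "set xs"] by (simp add: tuples_def)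
    then show ?thesis
      using that True by (auto simp: tuples_def distinct_map)
  qed
  have "?L \<longleftrightarrow> (\<forall>r\<in>J. \<forall>xs\<in>tuples k V. distinct xs \<longrightarrow> (E r (set xs) \<longleftrightarrow> F r (f ` set xs)))"
    using True tup by (auto simp: is_embedding_def hyper_def)
  also have "\<dots> \<longleftrightarrow> (\<forall>r\<in>J. \<forall>T\<in>[V]\<^bsup>k\<^esup>. E r T \<longleftrightarrow> F r (f ` T))"
    using set_nsets nsets_tuple by metis
  finally show ?thesis
    using True by simp
qed (auto simp: is_embedding_def)

text \<open>The relations of \<open>A\<close> are decided by images under \<open>f\<close>, so
  symmetry and distinctness of entries are inherited and the predicate is the pulled back
  one.\<close>

lemma is_embedding_into_hyper:
  assumes A: "is_structure (uniform_lang J k) A"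
    and f: "is_embedding (uniform_lang J k) A (hyper J k W F) f"
  shows "A = hyper J k (univ A) (\<lambda>r T. F r (f ` T))"
proof -
  have f': "inj_on f (univ A)" "f ` univ A \<subseteq> W"
    using f by (auto simp: is_embedding_def)
  have "xs \<in> rel A r \<longleftrightarrow> xs \<in> rel (hyper J k (univ A) (\<lambda>r T. F r (f ` T))) r" for xs r
  proof (cases "r \<in> J \<and> xs \<in> tuples k (univ A)")
    case True
    then have "xs \<in> rel A r \<longleftrightarrow> map f xs \<in> rel (hyper J k W F) r"
      using f by (auto simp: is_embedding_def)
    moreover have "inj_on f (set xs)"
      using True f'(1) inj_on_subset[of f "univ A" "set xs"] by (simp add: tuples_def)
    ultimately show ?thesis
      using True f'(2) by (auto simp: hyper_def tuples_def distinct_map)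
  next
    case False
    then show ?thesis
      using A by (auto simp: is_structure_def hyper_def)
  qed
  then have "rel A = rel (hyper J k (univ A) (\<lambda>r T. F r (f ` T)))"
    by (auto simp: fun_eq_iff)
  then show ?thesis
    by (simp add: hyper_def)
qed

subsection \<open>Coboundaries over the field with two elements\<close>

declare add_bit_eq_xor [simp del]

lemma bit_add_self: "x + x = (0 :: bit)"
  by (cases x) simp_all

lemma bit_add_eq_0_iff: "x + y = (0 :: bit) \<longleftrightarrow> x = y"
  by (cases x; cases y) simp_all

lemma of_nat_bit_eq_0_iff: "(of_nat m :: bit) = 0 \<longleftrightarrow> even m"
proof -
  have "even x \<longleftrightarrow> x = 0" for x :: bit
    by (cases x) simp_all
  then show ?thesis
    using even_of_nat by metis
qed

lemma of_bool_eq_1 [simp]: "of_bool (x = 1) = (x :: bit)"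
  by (cases x) simp_all

text \<open>The simplicial coboundary, without signs because of characteristic two. The degree is
  implicit in the size of the sets on which it is evaluated.\<close>

definition coboundary :: "('a set \<Rightarrow> bit) \<Rightarrow> 'a set \<Rightarrow> bit" where
  "coboundary c U = (\<Sum>u\<in>U. c (U - {u}))"

text \<open>Terms off the diagonal occur in equal pairs and cancel in characteristic two.\<close>

lemma sum_symmetric_bit:
  fixes f :: "'a \<Rightarrow> 'a \<Rightarrow> bit"
  assumes "finite U" "\<And>u w. f u w = f w u"
  shows "(\<Sum>u\<in>U. \<Sum>w\<in>U. f u w) = (\<Sum>u\<in>U. f u u)"
  using assms(1)
proof induction
  case (insert x U)
  have "(\<Sum>u\<in>insert x U. \<Sum>w\<in>insert x U. f u w) =
      f x x + (\<Sum>w\<in>U. f x w) + ((\<Sum>u\<in>U. f u x) + (\<Sum>u\<in>U. \<Sum>w\<in>U. f u w))"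
    using insert by (simp add: sum.distrib)
  also have "(\<Sum>u\<in>U. f u x) = (\<Sum>w\<in>U. f x w)"
    using assms(2) by simp
  finally show ?case
    using insert by (simp add: add.assoc)
qed simp

lemma coboundary_coboundary:
  assumes "finite U"
  shows "coboundary (coboundary c) U = 0"
proof -
  \<comment> \<open>Zero on the diagonal lets the double sum range over the full square; off it,
    \<open>f\<close> is symmetric because the order of two removals does not matter.\<close>
  define f where "f u w = (if u = w then 0 else c (U - {u, w}))" for u w
  have "coboundary (coboundary c) U = (\<Sum>u\<in>U. \<Sum>w\<in>U - {u}. c (U - {u} - {w}))"
    by (simp add: coboundary_def)
  also have "\<dots> = (\<Sum>u\<in>U. \<Sum>w\<in>U. f u w)"
  proof (rule sum.cong)
    fix u assume u: "u \<in> U"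
    have "U - {u} - {w} = U - {u, w}" for w
      by blast
    then have "(\<Sum>w\<in>U - {u}. c (U - {u} - {w})) = (\<Sum>w\<in>U - {u}. f u w)"
      by (intro sum.cong) (auto simp: f_def)
    also have "\<dots> = (\<Sum>w\<in>U. f u w)"
      using assms u by (simp add: sum.remove[of U u] f_def)
    finally show "(\<Sum>w\<in>U - {u}. c (U - {u} - {w})) = (\<Sum>w\<in>U. f u w)" .
  qed simp
  also have "\<dots> = (\<Sum>u\<in>U. f u u)"
    using assms by (rule sum_symmetric_bit) (simp add: f_def insert_commute)
  finally show ?thesis
    by (simp add: f_def)
qed

text \<open>This is the form in which cocycle conditions on cones and contractions are read: the
  face opposite \<open>v\<close> apart from the faces through it.\<close>

lemma coboundary_insert:
  assumes "finite T" "v \<notin> T"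
  shows "coboundary c (insert v T) = c T + (\<Sum>u\<in>T. c (insert v (T - {u})))"
proof -
  have "insert v T - {u} = insert v (T - {u})" if "u \<in> T" for u
    using assms that by blast
  then show ?thesis
    using assms by (simp add: coboundary_def)
qed

lemma coboundary_cong:
  assumes "U \<in> [V]\<^bsup>Suc k\<^esup>" "\<And>T. T \<in> [V]\<^bsup>k\<^esup> \<Longrightarrow> c T = d T"
  shows "coboundary c U = coboundary d U"
  unfolding coboundary_def using assms(2) nsets_diff[OF assms(1)] by (intro sum.cong) auto

lemma coboundary_image:
  assumes "inj_on f U"
  shows "coboundary c (f ` U) = coboundary (\<lambda>T. c (f ` T)) U"
proof -
  have "f ` U - {f u} = f ` (U - {u})" if "u \<in> U" for u
    using assms that by (simp add: inj_on_image_set_diff[of f U U "{u}", simplified])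
  then show ?thesis
    using assms by (simp add: coboundary_def sum.reindex)
qed

section \<open>Even hypergraphs as cocycles\<close>

definition cocycle :: "nat \<Rightarrow> 'a set \<Rightarrow> ('a set \<Rightarrow> bool) \<Rightarrow> bool" where
  "cocycle k V E \<longleftrightarrow> (\<forall>U\<in>[V]\<^bsup>Suc k\<^esup>. coboundary (\<lambda>T. of_bool (E T)) U = 0)"

lemma cocycle_image:
  assumes "cocycle k W F" "inj_on f V" "f ` V \<subseteq> W"
  shows "cocycle k V (\<lambda>T. F (f ` T))"
  unfolding cocycle_def
proof
  fix U assume U: "U \<in> [V]\<^bsup>Suc k\<^esup>"
  then have "f ` U \<in> [W]\<^bsup>Suc k\<^esup>"
    using nsets_image[OF U assms(2)] assms(3) nsets_mono by blast
  moreover have "inj_on f U"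
    using U assms(2) by (auto simp: nsets_def intro: inj_on_subset)
  ultimately show "coboundary (\<lambda>T. of_bool (F (f ` T))) U = 0"
    using assms(1) coboundary_image[of f U "\<lambda>T. of_bool (F T)"] by (simp add: cocycle_def)
qed

text \<open>Omitting a point is a bijection from the points of \<open>S\<close> to its
  \<open>k\<close>-subsets, so the coboundary counts the \<open>k\<close>-subsets with property
  \<open>P\<close> modulo two.\<close>

lemma coboundary_of_bool:
  assumes "finite S" "card S = Suc k"
  shows "coboundary (\<lambda>T. of_bool (P T)) S = 0 \<longleftrightarrow> even (card {e. e \<subseteq> S \<and> card e = k \<and> P e})"
proof -
  let ?N = "{u \<in> S. P (S - {u})}"
  have "coboundary (\<lambda>T. of_bool (P T)) S = of_nat (card (S \<inter> {u. P (S - {u})}))"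
    using assms(1) by (simp add: coboundary_def)
  also have "S \<inter> {u. P (S - {u})} = ?N"
    by blast
  finally have "coboundary (\<lambda>T. of_bool (P T)) S = of_nat (card ?N)" .
  moreover have "{e. e \<subseteq> S \<and> card e = k \<and> P e} = (\<lambda>u. S - {u}) ` ?N"
  proof
    show "{e. e \<subseteq> S \<and> card e = k \<and> P e} \<subseteq> (\<lambda>u. S - {u}) ` ?N"
    proof
      fix e assume e: "e \<in> {e. e \<subseteq> S \<and> card e = k \<and> P e}"
      then have "card (S - e) = 1"
        using assms finite_subset[of e S] by (simp add: card_Diff_subset)
      then obtain u where "S - e = {u}"
        by (auto simp: card_1_singleton_iff)
      then have "u \<in> S" "e = S - {u}"
        using e by auto
      then show "e \<in> (\<lambda>u. S - {u}) ` ?N"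
        using e by auto
    qed
  qed (use assms in auto)
  moreover have "inj_on (\<lambda>u. S - {u}) ?N"
    by (auto simp: inj_on_def)
  ultimately show ?thesis
    by (simp add: card_image of_nat_bit_eq_0_iff)
qed

lemma is_even_hypergraph_hyper:
  "is_even_hypergraph k (hyper UNIV k V E) \<longleftrightarrow> cocycle k V (E ())"
proof -
  have edge: "e \<subseteq> S \<and> card e = k \<and> (\<exists>xs\<in>rel (hyper UNIV k V E) (). set xs = e) \<longleftrightarrow>
      e \<subseteq> S \<and> card e = k \<and> E () e" if "finite S" "S \<subseteq> V" for e S
  proof (cases "e \<subseteq> S \<and> card e = k")
    case True
    then have "e \<in> [V]\<^bsup>k\<^esup>"
      using that finite_subset by (auto simp: nsets_def)
    then show ?thesis
      using edge_set_hyper[of "()" UNIV e V k E] by simp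
  qed auto
  have "is_even_hypergraph k (hyper UNIV k V E) \<longleftrightarrow>
      (\<forall>S\<subseteq>V. finite S \<and> card S = Suc k \<longrightarrow> even (card {e. e \<subseteq> S \<and> card e = k \<and> E () e}))"
    unfolding is_even_hypergraph_def is_hypergraph_def hypergraph_lang_eq
    by (simp add: is_structure_hyper hyperedge_relation_hyper edge cong: conj_cong)
  also have "\<dots> \<longleftrightarrow> cocycle k V (E ())"
    unfolding cocycle_def by (auto simp: nsets_def coboundary_of_bool)
  finally show ?thesis .
qed

text \<open>A single symbol gives the even hypergraphs and the index set
  \<open>I \<times> UNIV\<close> the merged class, so one extension argument settles both kinds of
  limit.\<close>

definition cocycle_class :: "'r set \<Rightarrow> nat \<Rightarrow> ('r, nat) struc set" where
  "cocycle_class J k = {hyper J k V E | V E. finite V \<and> (\<forall>r\<in>J. cocycle k V (E r))}"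

lemma even_hypergraph_class_eq: "even_hypergraph_class k = cocycle_class UNIV k"
proof (intro set_eqI iffI)
  fix A assume A: "A \<in> even_hypergraph_class k"
  then have "A = hyper UNIV k (univ A) (\<lambda>r T. T \<in> set ` rel A r)"
    by (intro hyper_of_relations)
      (auto simp: even_hypergraph_class_def is_even_hypergraph_def is_hypergraph_def hypergraph_lang_eq)
  then obtain E where E: "A = hyper UNIV k (univ A) E"
    by blast
  then have "is_even_hypergraph k (hyper UNIV k (univ A) E)" "finite (univ A)"
    using A by (simp_all add: even_hypergraph_class_def)
  then show "A \<in> cocycle_class UNIV k"
    unfolding cocycle_class_def is_even_hypergraph_hyper using E by (auto intro!: exI)
next
  fix A :: "(unit, nat) struc"
  assume "A \<in> cocycle_class UNIV k"
  then show "A \<in> even_hypergraph_class k"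
    by (auto simp: cocycle_class_def even_hypergraph_class_def is_even_hypergraph_hyper)
qed

lemma reduct_hyper:
  "i \<in> I \<Longrightarrow> reduct i (hyper (I \<times> UNIV) k V E) = hyper UNIV k V (\<lambda>u. E (i, u))"
  by (simp add: reduct_def hyper_def)

lemma merge_class_eq:
  fixes I :: "'i set"
  shows "merge_class I (\<lambda>_. hypergraph_lang k) (\<lambda>_. even_hypergraph_class k) = cocycle_class (I \<times> UNIV) k"
proof (intro set_eqI iffI)
  fix A :: "('i \<times> unit, nat) struc"
  assume A: "A \<in> merge_class I (\<lambda>_. hypergraph_lang k) (\<lambda>_. even_hypergraph_class k)"
  then have red: "is_even_hypergraph k (reduct i A)" if "i \<in> I" for i
    using that by (simp add: merge_class_def even_hypergraph_class_def)
  have "hyperedge_relation k (univ A) (rel A r)" if "r \<in> I \<times> UNIV" for r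
    using that red[of "fst r"] by (cases r) (auto simp: is_even_hypergraph_def is_hypergraph_def reduct_def)
  then have "A = hyper (I \<times> UNIV) k (univ A) (\<lambda>r T. T \<in> set ` rel A r)"
    using A by (intro hyper_of_relations) (auto simp: merge_class_def merge_lang_eq)
  then obtain E where E: "A = hyper (I \<times> UNIV) k (univ A) E"
    by blast
  have "cocycle k (univ A) (E (i, ()))" if "i \<in> I" for i
  proof -
    have "is_even_hypergraph k (hyper UNIV k (univ A) (\<lambda>u. E (i, u)))"
      using red[OF that] reduct_hyper[OF that, of k "univ A" E] E by simp
    then show ?thesis
      by (simp add: is_even_hypergraph_hyper)
  qed
  moreover have "finite (univ A)"
    using A by (simp add: merge_class_def)
  ultimately show "A \<in> cocycle_class (I \<times> UNIV) k"
    unfolding cocycle_class_def using E by (auto intro!: exI)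
next
  fix A :: "('i \<times> unit, nat) struc"
  assume "A \<in> cocycle_class (I \<times> UNIV) k"
  then obtain V E where "A = hyper (I \<times> UNIV) k V E" "finite V" "\<forall>r\<in>I \<times> UNIV. cocycle k V (E r)"
    by (auto simp: cocycle_class_def)
  then show "A \<in> merge_class I (\<lambda>_. hypergraph_lang k) (\<lambda>_. even_hypergraph_class k)"
    by (simp add: merge_class_def merge_lang_eq is_structure_hyper reduct_hyper
        even_hypergraph_class_def is_even_hypergraph_hyper)
qed

subsection \<open>The generic colored hypergraph\<close>

definition coloring :: "nat \<Rightarrow> nat \<Rightarrow> 'a set \<Rightarrow> ('a set \<Rightarrow> nat) \<Rightarrow> (nat, 'a) struc" where
  "coloring k m V c = hyper {..<m} k V (\<lambda>i T. c T = i)"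

lemma is_colored_hypergraph_coloring:
  assumes "\<And>T. T \<in> [V]\<^bsup>k\<^esup> \<Longrightarrow> c T < m"
  shows "is_colored_hypergraph k m (coloring k m V c)"
proof -
  have R: "rel (coloring k m V c) i = {xs \<in> tuples k V. distinct xs \<and> c (set xs) = i}" if "i < m" for i
    using that by (simp add: coloring_def hyper_def)
  have "disjoint_family_on (rel (coloring k m V c)) {..<m}"
    by (auto simp: disjoint_family_on_def R)
  moreover have "(\<Union>i<m. rel (coloring k m V c) i) = {xs \<in> tuples k V. distinct xs}"
    using assms set_nsets by (fastforce simp: R)
  ultimately show ?thesis
    by (simp add: is_colored_hypergraph_def colored_lang_eq coloring_def is_structure_hyper
        hyperedge_relation_hyper)
qed

text \<open>Every \<open>k\<close>-set carries a tuple without repetition, and the one relation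
  containing that tuple supplies the color.\<close>

lemma colored_hypergraph_coloring:
  assumes A: "is_colored_hypergraph k m A"
  obtains c where "A = coloring k m (univ A) c" "\<And>T. T \<in> [univ A]\<^bsup>k\<^esup> \<Longrightarrow> c T < m"
proof -
  have "A = hyper {..<m} k (univ A) (\<lambda>r T. T \<in> set ` rel A r)"
    using A by (intro hyper_of_relations) (auto simp: is_colored_hypergraph_def colored_lang_eq)
  then obtain E where E: "A = hyper {..<m} k (univ A) E"
    by blast
  have R: "rel A i = {xs \<in> tuples k (univ A). distinct xs \<and> E i (set xs)}" if "i < m" for i
    by (subst E) (use that in \<open>simp add: hyper_def\<close>)
  have "\<exists>!i. i < m \<and> E i T" if T: "T \<in> [univ A]\<^bsup>k\<^esup>" for T
  proof -
    obtain xs where xs: "xs \<in> tuples k (univ A)" "distinct xs" "set xs = T"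
      using nsets_tuple[OF T] .
    have mem: "xs \<in> rel A i \<longleftrightarrow> E i T" if "i < m" for i
      using R[OF that] xs by simp
    have "xs \<in> (\<Union>i<m. rel A i)"
      using A xs by (simp add: is_colored_hypergraph_def)
    then obtain i where "i < m" "xs \<in> rel A i"
      by blast
    moreover have "j = i" if "j < m" "xs \<in> rel A j" for j
      using A that \<open>i < m\<close> \<open>xs \<in> rel A i\<close>
      unfolding is_colored_hypergraph_def disjoint_family_on_def by blast
    ultimately show ?thesis
      using mem by blast
  qed
  then have "\<forall>T\<in>[univ A]\<^bsup>k\<^esup>. \<exists>j. j < m \<and> (\<forall>i<m. E i T \<longleftrightarrow> j = i)"
    by metis
  from bchoice[OF this] obtain c where c: "\<forall>T\<in>[univ A]\<^bsup>k\<^esup>. c T < m \<and> (\<forall>i<m. E i T \<longleftrightarrow> c T = i)"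
    by blast
  have "hyper {..<m} k (univ A) E = coloring k m (univ A) c"
    unfolding coloring_def using c by (intro hyper_cong) auto
  then show ?thesis
    using that[of c] E c by simp
qed

text \<open>The definition of a limit does not say that \<open>G\<close> is itself a colored
  hypergraph; this is read off its finite substructures. The color of \<open>T\<close> comes from a
  copy of \<open>T\<close> itself, and tuples with repetitions are excluded in copies of their sets
  of entries.\<close>

lemma generic_coloring:
  assumes G: "generic_colored_hypergraph k m G"
  obtains c where "G = coloring k m (univ G) c" "\<And>T. T \<in> [univ G]\<^bsup>k\<^esup> \<Longrightarrow> c T < m"
proof -
  have struct: "is_structure (colored_lang k m) G"
    and age: "age (colored_lang k m) G = colored_hypergraph_class k m"
    using G by (simp_all add: generic_colored_hypergraph_def is_fraisse_limit_def)
  have fin: "\<exists>d. (\<forall>T\<in>[S]\<^bsup>k\<^esup>. d T < m) \<and>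
      (\<forall>i<m. \<forall>xs\<in>tuples k S. xs \<in> rel G i \<longleftrightarrow> distinct xs \<and> d (set xs) = i)"
    if S: "finite S" "S \<subseteq> univ G" for S
  proof -
    obtain B e where B: "B \<in> age (colored_lang k m) G" "is_embedding (colored_lang k m) B G e"
      "e ` univ B = S"
      using finite_copy[OF struct S] .
    obtain b where b: "B = coloring k m (univ B) b" "\<And>T. T \<in> [univ B]\<^bsup>k\<^esup> \<Longrightarrow> b T < m"
      using B(1) colored_hypergraph_coloring unfolding age colored_hypergraph_class_def
      by (metis (no_types, lifting) mem_Collect_eq)
    have S_struct: "is_structure (colored_lang k m) (substructure G S)"
      using struct S by (auto simp: is_structure_def substructure_def tuples_def)
    define h where "h = inv_into (univ B) e \<circ> id"
    have "is_embedding (colored_lang k m) (substructure G S) G id"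
      using S by (simp add: is_embedding_substructure)
    then have h: "is_embedding (colored_lang k m) (substructure G S) B h"
      unfolding h_def by (rule is_embedding_factor[OF _ B(2)]) (simp add: B(3))
    have "is_embedding (uniform_lang {..<m} k) (substructure G S)
        (hyper {..<m} k (univ B) (\<lambda>i T. b T = i)) h"
      using h b(1) unfolding colored_lang_eq coloring_def by metis
    from is_embedding_into_hyper[OF S_struct[unfolded colored_lang_eq] this]
    have "substructure G S = coloring k m S (\<lambda>T. b (h ` T))"
      by (simp add: coloring_def)
    then have rel_G: "rel G i \<inter> lists S = (if i < m then {xs \<in> tuples k S. distinct xs \<and> b (h ` set xs) = i} else {})"
      for i
      unfolding substructure_def coloring_def hyper_def by (auto dest!: fun_cong[of _ _ i])
    have "xs \<in> rel G i \<longleftrightarrow> distinct xs \<and> b (h ` set xs) = i" if "i < m" "xs \<in> tuples k S" for i xs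
    proof -
      have "xs \<in> rel G i \<longleftrightarrow> xs \<in> rel G i \<inter> lists S"
        using that(2) by (auto simp: tuples_def)
      then show ?thesis
        using that unfolding rel_G by simp
    qed
    moreover have "b (h ` T) < m" if "T \<in> [S]\<^bsup>k\<^esup>" for T
    proof -
      have "inj_on h S" "h ` S \<subseteq> univ B"
        using h by (simp_all add: is_embedding_def)
      then have "h ` T \<in> [univ B]\<^bsup>k\<^esup>"
        using nsets_image[OF that] nsets_mono by blast
      then show ?thesis
        by (rule b(2))
    qed
    ultimately show ?thesis
      by (intro exI[of _ "\<lambda>T. b (h ` T)"]) simp
  qed
  have "\<forall>T\<in>[univ G]\<^bsup>k\<^esup>. \<exists>j. j < m \<and> (\<forall>i<m. \<forall>xs. set xs = T \<longrightarrow> distinct xs \<longrightarrow> (xs \<in> rel G i \<longleftrightarrow> j = i))"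
  proof
    fix T assume T: "T \<in> [univ G]\<^bsup>k\<^esup>"
    then have fT: "finite T" "T \<subseteq> univ G" "card T = k"
      by (auto simp: nsets_def)
    from fin[OF fT(1,2)] obtain d where d: "\<forall>T'\<in>[T]\<^bsup>k\<^esup>. d T' < m"
      "\<forall>i<m. \<forall>xs\<in>tuples k T. xs \<in> rel G i \<longleftrightarrow> distinct xs \<and> d (set xs) = i"
      by blast
    have "d T < m"
      using d(1) fT by (simp add: nsets_def)
    moreover have "xs \<in> rel G i \<longleftrightarrow> d T = i" if "i < m" "set xs = T" "distinct xs" for i xs
    proof -
      have "xs \<in> tuples k T"
        using that fT distinct_card[of xs] by (simp add: tuples_def)
      then show ?thesis
        using d(2) that by simp
    qed
    ultimately show "\<exists>j. j < m \<and> (\<forall>i<m. \<forall>xs. set xs = T \<longrightarrow> distinct xs \<longrightarrow> (xs \<in> rel G i \<longleftrightarrow> j = i))"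
      by blast
  qed
  from bchoice[OF this] obtain c where c: "\<forall>T\<in>[univ G]\<^bsup>k\<^esup>. c T < m \<and>
      (\<forall>i<m. \<forall>xs. set xs = T \<longrightarrow> distinct xs \<longrightarrow> (xs \<in> rel G i \<longleftrightarrow> c T = i))"
    by blast
  have "rel G i = rel (coloring k m (univ G) c) i" for i
  proof (cases "i < m")
    case True
    have sub: "rel G i \<subseteq> tuples k (univ G)"
      using struct True by (simp add: is_structure_def colored_lang_eq)
    have "xs \<in> rel G i \<longleftrightarrow> distinct xs \<and> c (set xs) = i" if xs: "xs \<in> tuples k (univ G)" for xs
    proof (cases "distinct xs")
      case True
      then show ?thesis
        using c set_nsets[OF xs] \<open>i < m\<close> by simp
    next
      case False
      have "finite (set xs)" "set xs \<subseteq> univ G" "xs \<in> tuples k (set xs)"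
        using xs by (simp_all add: tuples_def)
      then show ?thesis
        using fin[of "set xs"] False \<open>i < m\<close> by metis
    qed
    then show ?thesis
      using sub True by (auto simp: coloring_def hyper_def)
  next
    case False
    then show ?thesis
      using struct by (simp add: is_structure_def colored_lang_eq coloring_def hyper_def)
  qed
  then have "G = coloring k m (univ G) c"
    by (simp add: coloring_def hyper_def fun_eq_iff)
  then show ?thesis
    using that c by simp
qed

section \<open>Prescribing the colors at a new vertex\<close>

text \<open>As a member of the age, \<open>B\<close> has some embedding \<open>j\<close>. On
  \<open>A\<close>, the maps \<open>f\<close> and \<open>j\<close> give two copies of the same
  finite structure, and an automorphism of \<open>M\<close> taking the copy under \<open>j\<close>
  to the one under \<open>f\<close> corrects \<open>j\<close>.\<close>

lemma fraisse_limit_extend: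
  assumes M: "is_fraisse_limit L K M" and B: "B \<in> K" and A: "A \<subseteq> univ B"
    and f: "is_embedding L (substructure B A) M f"
  obtains g where "is_embedding L B M g" "\<And>x. x \<in> A \<Longrightarrow> g x = f x"
proof -
  have "B \<in> age L M" and uh: "ultrahomogeneous L M"
    using M B by (simp_all add: is_fraisse_limit_def)
  then obtain j where fin: "finite (univ B)" and j: "is_embedding L B M j"
    by (auto simp: age_def)
  let ?S = "j ` A" and ?i = "inv_into A j \<circ> id"
  have inj: "inj_on j A"
    using j A by (auto simp: is_embedding_def intro: inj_on_subset)
  have S: "?S \<subseteq> univ M" "finite ?S"
    using j A fin by (auto simp: is_embedding_def intro: finite_subset)
  have jA: "is_embedding L (substructure B A) M j"
    using j A by (rule is_embedding_restrict)
  have "is_embedding L (substructure M ?S) M id"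
    using S by (simp add: is_embedding_substructure)
  from is_embedding_factor[OF this jA] have "is_embedding L (substructure M ?S) (substructure B A) ?i"
    by simp
  then have "is_embedding L (substructure M ?S) M (f \<circ> ?i)"
    using f by (rule is_embedding_comp)
  then obtain a where a: "a \<in> Aut L M" "\<forall>x\<in>?S. a x = (f \<circ> ?i) x"
    using uh S unfolding ultrahomogeneous_def by metis
  have "is_embedding L B M (a \<circ> j)"
    using j a(1) by (auto simp: Aut_def intro: is_embedding_comp)
  moreover have "(a \<circ> j) x = f x" if "x \<in> A" for x
    using a(2) that inj by simp
  ultimately show ?thesis
    using that by blast
qed

text \<open>A vertex is added abstractly to a copy of the given points, with the colors prescribed
  by \<open>col\<close>, and the enlarged structure is embedded over the points already
  present.\<close>

lemma generic_coloring_extension: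
  assumes G: "generic_colored_hypergraph (Suc l) m (coloring (Suc l) m V c)"
    and c: "\<And>T. T \<in> [V]\<^bsup>Suc l\<^esup> \<Longrightarrow> c T < m"
    and S: "finite S" "S \<subseteq> V" and X: "finite X" and col: "\<And>T. col T < m"
  obtains v where "v \<in> V" "v \<notin> S" "v \<notin> X" "\<And>T. T \<in> [S]\<^bsup>l\<^esup> \<Longrightarrow> c (insert v T) = col T"
proof -
  \<comment> \<open>With the relevant part of \<open>X\<close> among the old points, injectivity
    makes the new vertex avoid \<open>X\<close>.\<close>
  define S1 where "S1 = S \<union> (X \<inter> V)"
  have S1: "finite S1" "S1 \<subseteq> V" "S \<subseteq> S1"
    using S X by (auto simp: S1_def)
  obtain g where g: "bij_betw g {0..<card S1} S1"
    using ex_bij_betw_nat_finite[OF S1(1)] by blast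
  define N where "N = card S1"
  have g: "inj_on g {..<N}" "g ` {..<N} = S1"
    using g by (simp_all add: bij_betw_def N_def atLeast0LessThan)
  \<comment> \<open>The numbers below \<open>N\<close> name the points of \<open>S1\<close>, and
    \<open>N\<close> is the new vertex. Sets through \<open>N\<close> that reach beyond
    \<open>S\<close> also get their color from \<open>col\<close>, which is why \<open>col\<close>
    is bounded on all sets.\<close>
  define b where "b T = (if N \<in> T then col (g ` (T - {N})) else c (g ` T))" for T
  let ?B = "coloring (Suc l) m {..N} b"
  have gT: "g ` T \<in> [V]\<^bsup>j\<^esup>" if "T \<in> [{..<N}]\<^bsup>j\<^esup>" for T j
    using nsets_image[OF that g(1)] nsets_mono[OF S1(2)] g(2) by auto
  have low: "T \<in> [{..<N}]\<^bsup>j\<^esup>" if "T \<in> [{..N}]\<^bsup>j\<^esup>" "N \<notin> T" for T j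
  proof -
    have "T \<subseteq> {..N} - {N}"
      using that by (auto simp: nsets_def)
    then have "T \<subseteq> {..<N}"
      by auto
    then show ?thesis
      using that(1) by (simp add: nsets_def)
  qed
  have "b T < m" if "T \<in> [{..N}]\<^bsup>Suc l\<^esup>" for T
    using c[OF gT[OF low[OF that]]] col by (simp add: b_def)
  then have "is_colored_hypergraph (Suc l) m ?B"
    by (rule is_colored_hypergraph_coloring)
  then have B: "?B \<in> colored_hypergraph_class (Suc l) m"
    by (simp add: colored_hypergraph_class_def coloring_def)
  have sub: "{..<N} \<subseteq> univ ?B"
    by (auto simp: coloring_def)
  have "substructure ?B {..<N} = coloring (Suc l) m {..<N} b"
    unfolding coloring_def by (rule substructure_hyper) auto
  moreover have "is_embedding (colored_lang (Suc l) m) (coloring (Suc l) m {..<N} b)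
      (coloring (Suc l) m V c) g"
    unfolding colored_lang_eq coloring_def is_embedding_hyper
  proof (intro conjI ballI)
    show "g ` {..<N} \<subseteq> V"
      using g(2) S1(2) by simp
    fix i T assume "T \<in> [{..<N}]\<^bsup>Suc l\<^esup>"
    then have "N \<notin> T"
      by (auto simp: nsets_def)
    then show "b T = i \<longleftrightarrow> c (g ` T) = i"
      by (simp add: b_def)
  qed (fact g(1))
  ultimately obtain h where h: "is_embedding (colored_lang (Suc l) m) ?B (coloring (Suc l) m V c) h"
    "\<And>x. x \<in> {..<N} \<Longrightarrow> h x = g x"
    using fraisse_limit_extend[OF G[unfolded generic_colored_hypergraph_def] B sub] by metis
  then have h_inj: "inj_on h {..N}" and hV: "h ` {..N} \<subseteq> V"
    and h_col: "\<And>i T. i < m \<Longrightarrow> T \<in> [{..N}]\<^bsup>Suc l\<^esup> \<Longrightarrow> b T = i \<longleftrightarrow> c (h ` T) = i"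
    unfolding colored_lang_eq coloring_def is_embedding_hyper by auto
  have new: "h N \<notin> S1"
  proof
    assume "h N \<in> S1"
    then obtain j where "j < N" "h N = h j"
      using g(2) h(2) by (metis imageE lessThan_iff)
    then show False
      using inj_onD[OF h_inj, of N j] by simp
  qed
  have "c (insert (h N) T) = col T" if "T \<in> [S]\<^bsup>l\<^esup>" for T
  proof -
    have "T \<in> [g ` {..<N}]\<^bsup>l\<^esup>"
      using that nsets_mono[OF S1(3)] g(2) by auto
    then obtain T0 where T0: "T0 \<in> [{..<N}]\<^bsup>l\<^esup>" "T = g ` T0"
      using g(1) by (rule nsets_imageE)
    then have T0': "T0 \<subseteq> {..<N}" "N \<notin> T0"
      by (auto simp: nsets_def)
    then have "h ` T0 = T"
      using h(2) T0(2) by (auto intro!: image_cong)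
    moreover have "insert N T0 \<in> [{..N}]\<^bsup>Suc l\<^esup>"
    proof (rule nsets_insert)
      have "{..<N} \<subseteq> {..N}"
        by auto
      then show "T0 \<in> [{..N}]\<^bsup>l\<^esup>"
        using T0(1) nsets_mono by blast
    qed (use T0' in auto)
    moreover have "b (insert N T0) = col T"
      using T0' T0(2) by (simp add: b_def)
    ultimately show ?thesis
      using h_col[OF col[of T], of "insert N T0"] by simp
  qed
  moreover have "h N \<in> V"
    using hV by auto
  moreover have "h N \<notin> S" "h N \<notin> X"
    using new \<open>h N \<in> V\<close> by (auto simp: S1_def)
  ultimately show ?thesis
    using that by blast
qed

subsection \<open>The cone over a colored hypergraph\<close>

definition cone_cochain :: "('a set \<Rightarrow> nat) \<Rightarrow> nat \<Rightarrow> 'a option set \<Rightarrow> bit" where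
  "cone_cochain c i T = (if None \<in> T then 0 else of_bool (bit (c (Some -` T)) i))"

definition cone_cocycle :: "('a set \<Rightarrow> nat) \<Rightarrow> nat \<Rightarrow> 'a option set \<Rightarrow> bit" where
  "cone_cocycle c i = coboundary (cone_cochain c i)"

text \<open>Every face except the one opposite the cone point contains \<open>None\<close>, where
  the cochain vanishes. The bits of the colors can thus be recovered from the cocycle.\<close>

lemma cone_cocycle_None:
  assumes "finite W"
  shows "cone_cocycle c i (insert None (Some ` W)) = of_bool (bit (c W) i)"
proof -
  have "Some -` Some ` W = W"
    by (simp add: inj_vimage_image_eq)
  then show ?thesis
    using assms by (simp add: cone_cocycle_def coboundary_insert cone_cochain_def)
qed

lemma coboundary_cone_cocycle: "finite U \<Longrightarrow> coboundary (cone_cocycle c i) U = 0"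
  by (simp add: cone_cocycle_def coboundary_coboundary)

lemma insert_None_Some_vimage: "None \<in> T \<Longrightarrow> T = insert None (Some ` (Some -` T))"
proof
  show "T \<subseteq> insert None (Some ` (Some -` T))"
  proof
    fix x assume "x \<in> T"
    then show "x \<in> insert None (Some ` (Some -` T))"
      by (cases x) auto
  qed
qed auto

lemma nsets_None:
  assumes "T \<in> [insert None (Some ` V)]\<^bsup>Suc k\<^esup>" "None \<in> T"
  obtains W where "W \<in> [V]\<^bsup>k\<^esup>" "T = insert None (Some ` W)"
proof -
  let ?W = "Some -` T"
  have T: "T = insert None (Some ` ?W)"
    using assms(2) by (rule insert_None_Some_vimage)
  have fin: "finite T" "card T = Suc k" "T \<subseteq> insert None (Some ` V)"
    using assms(1) by (simp_all add: nsets_def)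
  have W: "finite ?W"
    using fin(1) by (simp add: finite_vimageI)
  have "card (insert None (Some ` W)) = Suc (card W)" if "finite W" for W :: "'a set"
    using that by (simp add: card_insert_if image_iff card_image)
  then have "card ?W = k"
    using fin(2) W T by (metis Suc_inject)
  moreover have "?W \<subseteq> V"
    using fin(3) by auto
  ultimately show ?thesis
    using that[of ?W] T W by (simp add: nsets_def)
qed

text \<open>\<open>n\<close> independent parities have to be realized by one color;
  \<open>horner_sum\<close> assembles it from its bits.\<close>

lemma exists_bits: "\<exists>a :: nat. a < 2 ^ n \<and> (\<forall>i<n. bit a i \<longleftrightarrow> x i)"
proof -
  let ?a = "horner_sum of_bool 2 (map x [0..<n]) :: nat"
  have "take_bit n ?a = ?a"
    by (simp add: take_bit_horner_sum_bit_eq)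
  then have "?a < 2 ^ n"
    by (metis take_bit_nat_less_exp)
  then show ?thesis
    by (intro exI[of _ ?a]) (simp add: bit_horner_sum_bit_iff)
qed

lemma eq_of_bits_below:
  fixes a b :: nat
  assumes "a < 2 ^ n" "b < 2 ^ n" "\<And>i. i < n \<Longrightarrow> bit a i \<longleftrightarrow> bit b i"
  shows "a = b"
proof -
  have "take_bit n a = take_bit n b"
    using assms(3) by (auto simp: bit_eq_iff bit_take_bit_iff)
  then show ?thesis
    using assms(1,2) by (simp add: take_bit_nat_eq_self)
qed

text \<open>Cocycles pull back along injections. This settles both heredity and the inclusion of the
  age in the class.\<close>

lemma embedded_in_cocycles:
  fixes B :: "('r, nat) struc"
  assumes B: "is_structure (uniform_lang J k') B" "finite (univ B)"
    and f: "is_embedding (uniform_lang J k') B (hyper J k' W F) f"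
    and F: "\<And>r. r \<in> J \<Longrightarrow> cocycle k' W (F r)"
  shows "B \<in> cocycle_class J k'"
proof -
  have B_eq: "B = hyper J k' (univ B) (\<lambda>r T. F r (f ` T))"
    using B(1) f by (rule is_embedding_into_hyper)
  have "inj_on f (univ B)" "f ` univ B \<subseteq> W"
    using f by (simp_all add: is_embedding_def)
  then have "\<forall>r\<in>J. cocycle k' (univ B) (\<lambda>T. F r (f ` T))"
    using F cocycle_image by blast
  then show ?thesis
    unfolding cocycle_class_def using B_eq B(2) by blast
qed

section \<open>Realizing types in the cone\<close>

text \<open>What the cone asks of a generic coloring: the colors of the sets through a new vertex
  are free. The parameter \<open>l\<close> is the number of old points in such a set.\<close>

locale extensible_coloring =
  fixes k l n :: nat and V :: "'a set" and c :: "'a set \<Rightarrow> nat"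
  assumes k: "k = Suc l"
    and color_less: "T \<in> [V]\<^bsup>k\<^esup> \<Longrightarrow> c T < 2 ^ n"
    and color_extension: "finite S \<Longrightarrow> S \<subseteq> V \<Longrightarrow> finite X \<Longrightarrow> (\<And>T. col T < 2 ^ n) \<Longrightarrow>
      \<exists>v\<in>V. v \<notin> S \<and> v \<notin> X \<and> (\<forall>T\<in>[S]\<^bsup>l\<^esup>. c (insert v T) = col T)"
begin

abbreviation "cone \<equiv> insert None (Some ` V)"

abbreviation "cocyc \<equiv> cone_cocycle c"

text \<open>\<open>t i\<close> prescribes the cocycle on the sets through the new point, and the
  assumption for \<open>U\<close> is the cocycle condition on \<open>U\<close> with that point
  added. Sets through the cone point take their values from bits of colors; each remaining value is
  forced by the condition on one larger set, and the assumption makes it the prescribed one.\<close>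

lemma cone_extension_None:
  assumes S: "finite S" "S \<subseteq> cone" "None \<in> S" and X: "finite X" and I: "I \<subseteq> {..<n}"
    and t: "\<And>i U. i \<in> I \<Longrightarrow> U \<in> [S]\<^bsup>Suc k\<^esup> \<Longrightarrow> cocyc i U = coboundary (t i) U"
  shows "\<exists>v\<in>cone. v \<notin> S \<and> v \<notin> X \<and> (\<forall>i\<in>I. \<forall>T\<in>[S]\<^bsup>k\<^esup>. cocyc i (insert v T) = t i T)"
proof -
  define S0 where "S0 = Some -` S"
  have S0: "finite S0" "S0 \<subseteq> V" "S = insert None (Some ` S0)"
    using S insert_None_Some_vimage[of S] by (auto simp: S0_def finite_vimageI)
  \<comment> \<open>The color at \<open>W\<close> has to encode the values of all \<open>t i\<close>
    on the cone over \<open>W\<close>.\<close>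
  have "\<forall>W. \<exists>a :: nat. a < 2 ^ n \<and> (\<forall>i<n. bit a i \<longleftrightarrow> t i (insert None (Some ` W)) = 1)"
    by (intro allI exists_bits)
  from choice[OF this] obtain col :: "'a set \<Rightarrow> nat" where col: "\<And>W. col W < 2 ^ n"
    "\<And>W i. i < n \<Longrightarrow> bit (col W) i \<longleftrightarrow> t i (insert None (Some ` W)) = 1"
    by blast
  have "finite (Some -` X)"
    using X by (simp add: finite_vimageI)
  then obtain v where v: "v \<in> V" "v \<notin> S0" "v \<notin> Some -` X" "\<And>W. W \<in> [S0]\<^bsup>l\<^esup> \<Longrightarrow> c (insert v W) = col W"
    using color_extension[OF S0(1,2), of "Some -` X" col] col(1) by blast
  have vS: "Some v \<in> cone" "Some v \<notin> S" "Some v \<notin> X"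
    using v S0(3) by auto
  have with_None: "cocyc i (insert (Some v) T) = t i T"
    if i: "i \<in> I" and T: "T \<in> [S]\<^bsup>k\<^esup>" "None \<in> T" for i T
  proof -
    obtain W where W: "W \<in> [S0]\<^bsup>l\<^esup>" "T = insert None (Some ` W)"
      using T nsets_None[of T S0 l] by (auto simp: S0(3) k)
    have "insert (Some v) T = insert None (Some ` insert v W)"
      using W(2) by auto
    moreover have "finite (insert v W)"
      using W(1) by (simp add: nsets_def)
    ultimately have "cocyc i (insert (Some v) T) = of_bool (bit (c (insert v W)) i)"
      by (simp only: cone_cocycle_None)
    also have "\<dots> = of_bool (t i T = 1)"
      using v(4)[OF W(1)] col(2)[of i W] i I W(2) by auto
    also have "\<dots> = t i T"
      by (cases "t i T") simp_all
    finally show ?thesis .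
  qed
  have "cocyc i (insert (Some v) T) = t i T" if i: "i \<in> I" and T: "T \<in> [S]\<^bsup>k\<^esup>" for i T
  proof (cases "None \<in> T")
    case True
    then show ?thesis
      using with_None i T by blast
  next
    case False
    let ?U = "insert None T"
    have U: "?U \<in> [S]\<^bsup>Suc k\<^esup>"
      using T S(3) False by (rule nsets_insert)
    have T': "finite T" "Some v \<notin> ?U"
      using T vS(2) by (auto simp: nsets_def)
    have rest: "cocyc i (insert (Some v) (?U - {u})) = t i (?U - {u})" if "u \<in> T" for u
      using with_None[OF i nsets_diff[OF U, of u]] that False by auto
    \<comment> \<open>Of the faces of \<open>insert (Some v) ?U\<close>, those through both
      \<open>Some v\<close> and \<open>None\<close> are known, and \<open>?U\<close> is evaluated by
      the assumption on \<open>t\<close>; the face \<open>insert (Some v) T\<close> remains.\<close>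
    have "0 = cocyc i ?U + (\<Sum>u\<in>?U. cocyc i (insert (Some v) (?U - {u})))"
      using coboundary_cone_cocycle[of "insert (Some v) ?U" c i] T' by (simp add: coboundary_insert)
    also have "(\<Sum>u\<in>?U. cocyc i (insert (Some v) (?U - {u}))) =
        cocyc i (insert (Some v) T) + (\<Sum>u\<in>T. t i (?U - {u}))"
      using T' False rest by simp
    also have "cocyc i ?U = t i T + (\<Sum>u\<in>T. t i (?U - {u}))"
      using t[OF i U] T' False by (simp add: coboundary_def)
    finally have "0 = t i T + (\<Sum>u\<in>T. t i (?U - {u})) +
        (cocyc i (insert (Some v) T) + (\<Sum>u\<in>T. t i (?U - {u})))" .
    then show ?thesis
      by (cases "t i T"; cases "cocyc i (insert (Some v) T)"; cases "\<Sum>u\<in>T. t i (?U - {u})") simp_all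
  qed
  then show ?thesis
    using vS by blast
qed

text \<open>
  If the cone point is not among the given points, then it is adjoined to them first. The values of
  the new type on sets containing the cone point must be a cochain whose coboundary is the cocycle
  \<open>D\<close> below, and contracting \<open>D\<close> with any given point is such a cochain.
\<close>

lemma cone_extension:
  assumes S: "finite S" "S \<subseteq> cone" and X: "finite X" and I: "I \<subseteq> {..<n}"
    and t: "\<And>i U. i \<in> I \<Longrightarrow> U \<in> [S]\<^bsup>Suc k\<^esup> \<Longrightarrow> cocyc i U = coboundary (t i) U"
  shows "\<exists>v\<in>cone. v \<notin> S \<and> v \<notin> X \<and> (\<forall>i\<in>I. \<forall>T\<in>[S]\<^bsup>k\<^esup>. cocyc i (insert v T) = t i T)"
proof (cases "None \<in> S")
  case True
  then show ?thesis
    using cone_extension_None[OF S(1,2) True X I t] by blast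
next
  case False
  define D where "D i T = t i T + cocyc i (insert None T)" for i T
  \<comment> \<open>For empty \<open>S\<close> this is an arbitrary value, but the claim about
    \<open>F\<close> concerns sets of \<open>k\<close> \<ge> 1 points of \<open>S\<close>.\<close>
  define s where "s = (SOME s. s \<in> S)"
  define F where "F i W = (if s \<in> W then 0 else D i (insert s W))" for i W
  \<comment> \<open>On sets through \<open>None\<close> the value comes from \<open>F\<close>, whose
    coboundary \<open>D\<close> is the discrepancy between \<open>t\<close> and the cocycle on the
    cone; elsewhere \<open>t\<close> is kept.\<close>
  define t' where "t' i T = (if None \<in> T then F i (T - {None}) else t i T)" for i T
  let ?S = "insert None S"
  have D: "coboundary (D i) U = 0" if i: "i \<in> I" and U: "U \<in> [S]\<^bsup>Suc k\<^esup>" for i U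
  proof -
    have fin: "finite U" "None \<notin> U"
      using U False by (auto simp: nsets_def)
    have "coboundary (D i) U = coboundary (t i) U + (\<Sum>u\<in>U. cocyc i (insert None (U - {u})))"
      by (simp add: coboundary_def D_def sum.distrib)
    \<comment> \<open>The assumption on \<open>t\<close> turns \<open>coboundary (t i) U\<close>
      into \<open>cocyc i U\<close>, the face opposite \<open>None\<close>.\<close>
    also have "\<dots> = coboundary (cocyc i) (insert None U)"
      using fin t[OF i U] by (simp add: coboundary_insert)
    finally show ?thesis
      using fin by (simp add: coboundary_cone_cocycle)
  qed
  have F: "coboundary (F i) T = D i T" if i: "i \<in> I" and T: "T \<in> [S]\<^bsup>k\<^esup>" for i T
  \<comment> \<open>If \<open>s\<close> is in \<open>T\<close>, only the face omitting
    \<open>s\<close> contributes; otherwise the cocycle condition for \<open>D\<close> on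
    \<open>insert s T\<close> gives the value.\<close>
  proof (cases "s \<in> T")
    case True
    then obtain R where R: "T = insert s R" "s \<notin> R"
      by (meson mk_disjoint_insert)
    moreover have "finite R"
      using T R by (simp add: nsets_def)
    ultimately show ?thesis
      by (simp add: coboundary_insert F_def)
  next
    case s: False
    have fin: "finite T" "T \<noteq> {}" "T \<subseteq> S"
      using T by (auto simp: nsets_def k)
    then have "s \<in> S"
      unfolding s_def using some_in_eq[of S] by blast
    then have "coboundary (D i) (insert s T) = 0"
      using D[OF i nsets_insert[OF T _ s]] by simp
    moreover have "(\<Sum>u\<in>T. D i (insert s (T - {u}))) = coboundary (F i) T"
      using s by (simp add: coboundary_def F_def)
    ultimately show ?thesis
      using fin s by (simp add: coboundary_insert bit_add_eq_0_iff)
  qed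
  have t': "cocyc i U = coboundary (t' i) U" if i: "i \<in> I" and U: "U \<in> [?S]\<^bsup>Suc k\<^esup>" for i U
  proof (cases "None \<in> U")
    case True
    define T where "T = U - {None}"
    have U_eq: "U = insert None T" "None \<notin> T"
      using True by (auto simp: T_def)
    have "T \<in> [?S]\<^bsup>k\<^esup>"
      unfolding T_def using U True by (rule nsets_diff)
    then have T: "T \<in> [S]\<^bsup>k\<^esup>" "finite T"
      using U_eq(2) by (auto simp: nsets_def)
    have "(\<Sum>u\<in>T. t' i (insert None (T - {u}))) = coboundary (F i) T"
      unfolding coboundary_def
    proof (rule sum.cong)
      fix u
      have "insert None (T - {u}) - {None} = T - {u}"
        using U_eq(2) by auto
      then show "t' i (insert None (T - {u})) = F i (T - {u})"
        by (simp add: t'_def)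
    qed simp
    then have "coboundary (t' i) U = t i T + D i T"
      using T U_eq F[OF i T(1)] by (simp add: coboundary_insert t'_def)
    also have "\<dots> = cocyc i U"
      unfolding D_def U_eq(1) by (simp add: bit_add_self flip: add.assoc)
    finally show ?thesis ..
  next
    case False
    then have U': "U \<in> [S]\<^bsup>Suc k\<^esup>"
      using U by (auto simp: nsets_def)
    have "coboundary (t' i) U = coboundary (t i) U"
      using False by (simp add: coboundary_def t'_def)
    then show ?thesis
      using t[OF i U'] by simp
  qed
  have S': "finite ?S" "?S \<subseteq> cone" "None \<in> ?S"
    using S by auto
  obtain v where v: "v \<in> cone" "v \<notin> ?S" "v \<notin> X"
    "\<forall>i\<in>I. \<forall>T\<in>[?S]\<^bsup>k\<^esup>. cocyc i (insert v T) = t' i T"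
    using cone_extension_None[OF S' X I t'] by blast
  have "cocyc i (insert v T) = t i T" if "i \<in> I" "T \<in> [S]\<^bsup>k\<^esup>" for i T
  proof -
    have "T \<in> [?S]\<^bsup>k\<^esup>" "None \<notin> T"
      using that(2) False by (auto simp: nsets_def)
    then show ?thesis
      using v(4) that(1) by (simp add: t'_def)
  qed
  then show ?thesis
    using v by blast
qed

section \<open>The cone as a Fraisse limit\<close>

text \<open>\<open>\<phi>\<close> assigns a bit position to each symbol: \<open>fst\<close> yields
  the merge, and a constant yields a single even hypergraph.\<close>

definition cone_struc :: "'r set \<Rightarrow> ('r \<Rightarrow> nat) \<Rightarrow> ('r, 'a option) struc" where
  "cone_struc J \<phi> = hyper J (Suc k) cone (\<lambda>r U. cocyc (\<phi> r) U = 1)"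

text \<open>Injectivity of \<open>\<phi>\<close> lets a type in several symbols be split into types
  for different bits. Transported along \<open>f\<close>, the edges of \<open>B\<close> through
  \<open>b\<close> become the data \<open>t\<close>, and the cocycle conditions of \<open>B\<close>
  on sets through \<open>b\<close> become its compatibility.\<close>

lemma extension_property_cone:
  fixes J :: "'r set"
  assumes \<phi>: "inj_on \<phi> J" "\<phi> ` J \<subseteq> {..<n}" and V: "countable V"
  shows "extension_property (uniform_lang J (Suc k)) (cocycle_class J (Suc k)) (cone_struc J \<phi>)"
proof
  show "arity (uniform_lang J (Suc k)) r > 0" if "r \<in> symb (uniform_lang J (Suc k))" for r
    by simp
  show "is_structure (uniform_lang J (Suc k)) (cone_struc J \<phi>)"
    by (simp add: cone_struc_def is_structure_hyper)
  show "countable (univ (cone_struc J \<phi>))"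
    using V by (simp add: cone_struc_def)
  show "is_structure (uniform_lang J (Suc k)) B \<and> finite (univ B)"
    if "B \<in> cocycle_class J (Suc k)" for B
    using that by (auto simp: cocycle_class_def is_structure_hyper)
  then show "hereditary (uniform_lang J (Suc k)) (cocycle_class J (Suc k))"
    unfolding hereditary_def
  proof (intro ballI allI impI; elim conjE exE)
    fix A B :: "('r, nat) struc" and f
    assume A: "A \<in> cocycle_class J (Suc k)" and B: "is_structure (uniform_lang J (Suc k)) B"
      and f: "is_embedding (uniform_lang J (Suc k)) B A f"
    obtain W F where W: "A = hyper J (Suc k) W F" "finite W" "\<forall>r\<in>J. cocycle (Suc k) W (F r)"
      using A by (auto simp: cocycle_class_def)
    have "inj_on f (univ B)" "f ` univ B \<subseteq> W"
      using f W(1) by (simp_all add: is_embedding_def)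
    then have "finite (univ B)"
      using W(2) by (meson inj_on_finite)
    then show "B \<in> cocycle_class J (Suc k)"
      using embedded_in_cocycles[OF B] f W by blast
  qed
  show "age (uniform_lang J (Suc k)) (cone_struc J \<phi>) \<subseteq> cocycle_class J (Suc k)"
  proof
    fix B assume "B \<in> age (uniform_lang J (Suc k)) (cone_struc J \<phi>)"
    then obtain f where B: "is_structure (uniform_lang J (Suc k)) B" "finite (univ B)"
      "is_embedding (uniform_lang J (Suc k)) B (cone_struc J \<phi>) f"
      by (auto simp: age_def)
    have "cocycle (Suc k) cone (\<lambda>U. cocyc (\<phi> r) U = 1)" for r
      unfolding cocycle_def by (auto simp: nsets_def coboundary_cone_cocycle)
    then show "B \<in> cocycle_class J (Suc k)"
      using embedded_in_cocycles[OF B(1,2) B(3)[unfolded cone_struc_def]] by blast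
  qed
  show "\<exists>v. v \<notin> X \<and> is_embedding (uniform_lang J (Suc k)) B (cone_struc J \<phi>) (f(b := v))"
    if B: "B \<in> cocycle_class J (Suc k)" and b: "b \<in> univ B"
      and f: "is_embedding (uniform_lang J (Suc k)) (substructure B (univ B - {b})) (cone_struc J \<phi>) f"
      and X: "finite X" for B b f X
  proof -
    obtain W F where W: "B = hyper J (Suc k) W F" "finite W" "\<And>r. r \<in> J \<Longrightarrow> cocycle (Suc k) W (F r)"
      using B by (auto simp: cocycle_class_def)
    define W0 where "W0 = W - {b}"
    have W0: "W0 \<subseteq> W" "b \<notin> W0" "W = insert b W0" "finite W0"
      using W b by (auto simp: W0_def)
    have f': "inj_on f W0" "f ` W0 \<subseteq> cone"
      "\<And>r T. r \<in> J \<Longrightarrow> T \<in> [W0]\<^bsup>Suc k\<^esup> \<Longrightarrow> F r T \<longleftrightarrow> cocyc (\<phi> r) (f ` T) = 1"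
      using f W0(1) by (simp_all add: W(1) W0_def[symmetric] substructure_hyper cone_struc_def
          is_embedding_hyper)
    define t where "t i T = (of_bool (F (inv_into J \<phi> i) (insert b (inv_into W0 f ` T))) :: bit)" for i T
    have t: "t (\<phi> r) (f ` T) = of_bool (F r (insert b T))" if "r \<in> J" "T \<subseteq> W0" for r T
      using that \<phi>(1) f'(1) by (simp add: t_def inv_into_image_cancel)
    have t_cocycle: "cocyc i U = coboundary (t i) U"
      if i: "i \<in> \<phi> ` J" and U: "U \<in> [f ` W0]\<^bsup>Suc k\<^esup>" for i U
    proof -
      obtain r where r: "r \<in> J" "i = \<phi> r"
        using i by blast
      obtain U0 where U0: "U0 \<in> [W0]\<^bsup>Suc k\<^esup>" "U = f ` U0"
        using U f'(1) by (rule nsets_imageE)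
      have U0': "U0 \<subseteq> W0" "finite U0" "b \<notin> U0"
        using U0(1) W0(2) by (auto simp: nsets_def)
      have "inj_on f U0"
        using f'(1) U0'(1) by (rule inj_on_subset)
      then have "coboundary (t i) U = coboundary (\<lambda>T. t i (f ` T)) U0"
        unfolding U0(2) by (rule coboundary_image)
      also have "\<dots> = (\<Sum>u\<in>U0. of_bool (F r (insert b (U0 - {u}))))"
        unfolding coboundary_def r(2) using U0'(1) by (intro sum.cong refl t r(1)) blast
      also have "\<dots> = of_bool (F r U0)"
      proof -
        have "insert b U0 \<in> [W]\<^bsup>Suc (Suc k)\<^esup>"
          using nsets_insert[of U0 W "Suc k" b] U0(1) nsets_mono[OF W0(1)] U0'(3) W0(3) by blast
        then have "coboundary (\<lambda>T. of_bool (F r T)) (insert b U0) = 0"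
          using W(3)[OF r(1)] by (simp add: cocycle_def)
        then show ?thesis
          using U0' by (simp add: coboundary_insert bit_add_eq_0_iff)
      qed
      also have "\<dots> = cocyc i U"
        using f'(3)[OF r(1) U0(1)] by (simp add: r(2) U0(2))
      finally show ?thesis ..
    qed
    obtain v where v: "v \<in> cone" "v \<notin> f ` W0" "v \<notin> X"
      "\<forall>i\<in>\<phi> ` J. \<forall>T\<in>[f ` W0]\<^bsup>k\<^esup>. cocyc i (insert v T) = t i T"
      using cone_extension[OF finite_imageI[OF W0(4)] f'(2) X \<phi>(2) t_cocycle] by blast
    let ?g = "f(b := v)"
    have g: "?g ` T = f ` T" if "T \<subseteq> W0" for T
      using that W0(2) by (intro image_cong) auto
    have "is_embedding (uniform_lang J (Suc k)) B (cone_struc J \<phi>) ?g"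
      unfolding W(1) cone_struc_def is_embedding_hyper
    proof (intro conjI ballI)
      show "inj_on ?g W"
        unfolding W0(3) using f'(1) W0(2) v(2) g[of W0]
        by (auto simp: inj_on_fun_updI)
      show "?g ` W \<subseteq> cone"
        unfolding W0(3) image_insert g[OF order_refl] using f'(2) v(1) by simp
      fix r T assume r: "r \<in> J" and T: "T \<in> [W]\<^bsup>Suc k\<^esup>"
      show "F r T \<longleftrightarrow> cocyc (\<phi> r) (?g ` T) = 1"
      proof (cases "b \<in> T")
        case True
        define T0 where "T0 = T - {b}"
        have T0: "T = insert b T0" "T0 \<in> [W]\<^bsup>k\<^esup>" "b \<notin> T0"
          using True nsets_diff[OF T True] by (auto simp: T0_def)
        then have T0': "T0 \<in> [W0]\<^bsup>k\<^esup>" "T0 \<subseteq> W0"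
          unfolding W0(3) by (auto simp: nsets_def)
        have "?g ` T = insert v (f ` T0)"
          unfolding T0(1) image_insert g[OF T0'(2)] by simp
        then have "cocyc (\<phi> r) (?g ` T) = of_bool (F r T)"
          using v(4) r nsets_image[OF T0'(1) f'(1)] t[OF r T0'(2)] T0(1) by simp
        then show ?thesis
          by simp
      next
        case False
        then have "T \<in> [W0]\<^bsup>Suc k\<^esup>" "T \<subseteq> W0"
          using T unfolding W0(3) by (auto simp: nsets_def)
        then show ?thesis
          using f'(3)[OF r] g by simp
      qed
    qed
    then show ?thesis
      using v(3) by blast
  qed
qed

lemma transitive_cone:
  assumes "ultrahomogeneous (uniform_lang J (Suc k)) (cone_struc J \<phi>)"
  shows "transitive_on (Aut (uniform_lang J (Suc k)) (cone_struc J \<phi>)) (univ (cone_struc J \<phi>))"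
  unfolding transitive_on_def
proof (intro ballI)
  fix x y assume xy: "x \<in> univ (cone_struc J \<phi>)" "y \<in> univ (cone_struc J \<phi>)"
  \<comment> \<open>Edges have \<open>Suc k\<close> \<ge> 2 points, so a single point carries no
    structure and every map between two points is a partial isomorphism.\<close>
  have "[{x}]\<^bsup>Suc k\<^esup> = {}"
    by (simp add: nsets_eq_empty k)
  then have "is_embedding (uniform_lang J (Suc k)) (substructure (cone_struc J \<phi>) {x}) (cone_struc J \<phi>) (\<lambda>_. y)"
    using xy by (simp add: cone_struc_def substructure_hyper is_embedding_hyper)
  then obtain g where "g \<in> Aut (uniform_lang J (Suc k)) (cone_struc J \<phi>)" "\<forall>z\<in>{x}. g z = y"
    using assms xy unfolding ultrahomogeneous_def
    by (metis empty_subsetI finite.emptyI finite.insertI insert_subset)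
  then show "\<exists>f\<in>Aut (uniform_lang J (Suc k)) (cone_struc J \<phi>). f x = y"
    by blast
qed

section \<open>Comparison of the automorphism groups\<close>

text \<open>On sets through \<open>None\<close> the cocycles are the bits of the colors, and all
  \<open>n\<close> bits are seen because \<open>\<phi>\<close> is onto, so an automorphism fixing
  \<open>None\<close> preserves colors. Conversely, an automorphism of the coloring preserves the
  cochain on the cone, and hence its coboundary.\<close>

lemma cone_one_point_extension:
  assumes \<phi>: "\<phi> ` J = {..<n}"
  shows "one_point_extension (colored_lang k (2 ^ n)) (coloring k (2 ^ n) V c)
    (uniform_lang J (Suc k)) (cone_struc J \<phi>)"
proof -
  let ?G = "coloring k (2 ^ n) V c" and ?L = "colored_lang k (2 ^ n)"
  let ?G' = "cone_struc J \<phi>" and ?L' = "uniform_lang J (Suc k)"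
  have univ: "univ ?G = V" "univ ?G' = cone"
    by (simp_all add: coloring_def cone_struc_def)
  have AutG: "g \<in> Aut ?L ?G \<longleftrightarrow> g permutes V \<and> (\<forall>T\<in>[V]\<^bsup>k\<^esup>. c (g ` T) = c T)" for g
  proof -
    have "is_embedding ?L ?G ?G g \<longleftrightarrow> (\<forall>i<2 ^ n. \<forall>T\<in>[V]\<^bsup>k\<^esup>. c T = i \<longleftrightarrow> c (g ` T) = i)" if "g permutes V"
      using permutes_inj_on[OF that] permutes_image[OF that]
      by (auto simp: colored_lang_eq coloring_def is_embedding_hyper)
    also have "\<dots> \<longleftrightarrow> (\<forall>T\<in>[V]\<^bsup>k\<^esup>. c (g ` T) = c T)"
      using color_less by metis
    finally show ?thesis
      unfolding Aut_def univ by blast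
  qed
  have AutG': "f \<in> Aut ?L' ?G' \<longleftrightarrow>
      f permutes cone \<and> (\<forall>i<n. \<forall>T\<in>[cone]\<^bsup>Suc k\<^esup>. cocyc i (f ` T) = cocyc i T)" for f
  proof -
    have "is_embedding ?L' ?G' ?G' f \<longleftrightarrow> (\<forall>r\<in>J. \<forall>T\<in>[cone]\<^bsup>Suc k\<^esup>. cocyc (\<phi> r) T = 1 \<longleftrightarrow> cocyc (\<phi> r) (f ` T) = 1)"
      if "f permutes cone"
      unfolding cone_struc_def is_embedding_hyper
      using permutes_inj_on[OF that, of cone] equalityD1[OF permutes_image[OF that]] by meson
    also have "\<dots> \<longleftrightarrow> (\<forall>i\<in>\<phi> ` J. \<forall>T\<in>[cone]\<^bsup>Suc k\<^esup>. cocyc i (f ` T) = cocyc i T)"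
    proof -
      have "(x = 1 \<longleftrightarrow> y = 1) \<longleftrightarrow> y = x" for x y :: bit
        by (cases x; cases y) simp_all
      then show ?thesis
        by simp
    qed
    finally show ?thesis
      unfolding Aut_def univ \<phi> by blast
  qed
  have "{g. \<exists>f\<in>Aut ?L' ?G'. f None = None \<and> (\<forall>x. f (Some x) = Some (g x))} = Aut ?L ?G"
  proof (intro set_eqI iffI)
    fix g assume "g \<in> {g. \<exists>f\<in>Aut ?L' ?G'. f None = None \<and> (\<forall>x. f (Some x) = Some (g x))}"
    then obtain f where f: "f permutes cone" "\<And>i T. i < n \<Longrightarrow> T \<in> [cone]\<^bsup>Suc k\<^esup> \<Longrightarrow> cocyc i (f ` T) = cocyc i T"
      "f None = None" "\<And>x. f (Some x) = Some (g x)"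
      by (auto simp: AutG')
    have "g permutes V"
    proof (rule bij_imp_permutes)
      have inj: "inj g"
        using permutes_inj[OF f(1)] f(4) by (metis injI injD option.inject)
      have "f ` cone = insert None (Some ` g ` V)"
        using f(3,4) by (simp add: image_image)
      then have "insert None (Some ` g ` V) = insert None (Some ` V)"
        using permutes_image[OF f(1)] by simp
      then have "Some -` insert None (Some ` g ` V) = Some -` insert None (Some ` V)"
        by simp
      then have "g ` V = V"
        by (auto simp: vimage_def)
      then show "bij_betw g V V"
        using inj_on_subset[OF inj subset_UNIV] by (simp add: bij_betw_def)
      show "g x = x" if "x \<notin> V" for x
        using permutes_not_in[OF f(1), of "Some x"] f(4) that by auto
    qed
    moreover have "c (g ` T) = c T" if T: "T \<in> [V]\<^bsup>k\<^esup>" for T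
    proof (rule eq_of_bits_below)
      have gT: "g ` T \<in> [V]\<^bsup>k\<^esup>"
        using nsets_image[OF T, of g] permutes_inj_on[OF \<open>g permutes V\<close>] permutes_image[OF \<open>g permutes V\<close>]
        by simp
      then show "c (g ` T) < 2 ^ n" "c T < 2 ^ n"
        using T color_less by auto
      fix i assume i: "i < n"
      have fin: "finite T" "finite (g ` T)"
        using T by (simp_all add: nsets_def)
      have "Some ` T \<in> [cone]\<^bsup>k\<^esup>"
        using T by (auto simp: nsets_def card_image)
      then have "insert None (Some ` T) \<in> [cone]\<^bsup>Suc k\<^esup>"
        by (rule nsets_insert) auto
      moreover have "f ` insert None (Some ` T) = insert None (Some ` g ` T)"
        using f(3,4) by (simp add: image_image)
      ultimately have "cocyc i (insert None (Some ` g ` T)) = cocyc i (insert None (Some ` T))"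
        using f(2)[OF i] by metis
      then show "bit (c (g ` T)) i \<longleftrightarrow> bit (c T) i"
        unfolding cone_cocycle_None[OF fin(1)] cone_cocycle_None[OF fin(2)] of_bool_eq_iff .
    qed
    ultimately show "g \<in> Aut ?L ?G"
      by (simp add: AutG)
  next
    fix g assume "g \<in> Aut ?L ?G"
    then have g: "g permutes V" "\<And>T. T \<in> [V]\<^bsup>k\<^esup> \<Longrightarrow> c (g ` T) = c T"
      by (simp_all add: AutG)
    let ?f = "map_option g"
    have "?f permutes cone"
    proof (rule bij_imp_permutes)
      have "?f ` cone = insert None (Some ` g ` V)"
        by (simp add: image_image)
      moreover have "inj_on ?f cone"
        using option.inj_map[OF permutes_inj[OF g(1)]] subset_UNIV by (rule inj_on_subset)
      ultimately show "bij_betw ?f cone cone"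
        using permutes_image[OF g(1)] by (simp add: bij_betw_def)
      show "?f x = x" if "x \<notin> cone" for x
        using that permutes_not_in[OF g(1)] by (cases x) auto
    qed
    moreover have "cocyc i (?f ` U) = cocyc i U" if U: "U \<in> [cone]\<^bsup>Suc k\<^esup>" for i U
    proof -
      have "cone_cochain c i (?f ` T) = cone_cochain c i T" if T: "T \<in> [cone]\<^bsup>k\<^esup>" for T
      proof (cases "None \<in> T")
        case True
        then have "None \<in> ?f ` T"
          by force
        then show ?thesis
          using True by (simp add: cone_cochain_def)
      next
        case False
        then have "T \<subseteq> Some ` V"
          using T by (auto simp: nsets_def)
        then obtain W where W: "T = Some ` W" "W \<subseteq> V"
          by (meson subset_imageE)
        have "W \<in> [V]\<^bsup>k\<^esup>"
          using T W by (auto simp: nsets_def card_image finite_image_iff)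
        moreover have "Some -` T = W" "?f ` T = Some ` g ` W"
          using W by (auto simp: inj_vimage_image_eq image_image)
        ultimately show ?thesis
          using False g(2) by (auto simp: cone_cochain_def inj_vimage_image_eq)
      qed
      then have "coboundary (\<lambda>T. cone_cochain c i (?f ` T)) U = cocyc i U"
        unfolding cone_cocycle_def by (rule coboundary_cong[OF U])
      moreover have "inj_on ?f U"
        using option.inj_map[OF permutes_inj[OF g(1)]] subset_UNIV by (rule inj_on_subset)
      ultimately show ?thesis
        unfolding cone_cocycle_def by (simp add: coboundary_image)
    qed
    ultimately have "?f \<in> Aut ?L' ?G'"
      by (simp add: AutG')
    then show "g \<in> {g. \<exists>f\<in>Aut ?L' ?G'. f None = None \<and> (\<forall>x. f (Some x) = Some (g x))}"
      by (intro CollectI bexI[of _ ?f]) simp_all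
  qed
  then show ?thesis
    unfolding one_point_extension_def univ by (simp add: cone_struc_def is_structure_hyper)
qed

end

theorem corollary3p4:
  fixes k n :: nat and G :: "(nat, 'a) struc"
  assumes "k \<ge> 2"
    and "generic_colored_hypergraph k (2 ^ n) G"
  shows "\<exists>(G' :: (nat \<times> unit, 'a option) struc) (H :: nat \<Rightarrow> (unit, 'a option) struc).
           transitive_one_point_extension
             (colored_lang k (2 ^ n)) G
             (merge_lang {..<n} (\<lambda>_. hypergraph_lang (k + 1))) G' \<and>
           (\<forall>i<n. generic_even_hypergraph (k + 1) (H i)) \<and>
           is_merge {..<n} (\<lambda>_. hypergraph_lang (k + 1)) H G'"
proof -
  obtain l where l: "k = Suc l"
    using assms(1) by (cases k) auto
  obtain c :: "'a set \<Rightarrow> nat" where c: "G = coloring k (2 ^ n) (univ G) c" "\<And>T. T \<in> [univ G]\<^bsup>k\<^esup> \<Longrightarrow> c T < 2 ^ n"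
    using generic_coloring[OF assms(2)] by blast
  have gen: "generic_colored_hypergraph (Suc l) (2 ^ n) (coloring (Suc l) (2 ^ n) (univ G) c)"
    using assms(2) c(1) l by simp
  interpret extensible_coloring k l n "univ G" c
  proof
    fix S X :: "'a set" and col :: "'a set \<Rightarrow> nat"
    assume "finite S" "S \<subseteq> univ G" "finite X" "\<And>T. col T < 2 ^ n"
    then obtain v where "v \<in> univ G" "v \<notin> S" "v \<notin> X" "\<And>T. T \<in> [S]\<^bsup>l\<^esup> \<Longrightarrow> c (insert v T) = col T"
      using generic_coloring_extension[OF gen c(2)[unfolded l]] by metis
    then show "\<exists>v\<in>univ G. v \<notin> S \<and> v \<notin> X \<and> (\<forall>T\<in>[S]\<^bsup>l\<^esup>. c (insert v T) = col T)"
      by blast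
  qed (use l c(2) in auto)
  have V: "countable (univ G)"
    using assms(2) by (simp add: generic_colored_hypergraph_def is_fraisse_limit_def)
  let ?J = "{..<n} \<times> (UNIV :: unit set)"
  let ?G' = "cone_struc ?J fst"
  \<comment> \<open>For \<open>i\<close> below \<open>n\<close> this is the reduct of
    \<open>?G'\<close> at \<open>i\<close>, the even hypergraph carried by bit
    \<open>i\<close>.\<close>
  define H where "H i = cone_struc (UNIV :: unit set) (\<lambda>_. i)" for i
  have fst: "inj_on fst ?J" "fst ` ?J = {..<n}"
    by (auto simp: inj_on_def)
  \<comment> \<open>For \<open>n = 0\<close> the language of the merge is empty, and this instance
    describes a countable pure set.\<close>
  interpret G': extension_property "uniform_lang ?J (Suc k)" "cocycle_class ?J (Suc k)" ?G'
    using fst V by (intro extension_property_cone) auto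
  have H: "extension_property (uniform_lang UNIV (Suc k)) (cocycle_class UNIV (Suc k)) (H i)"
    if "i < n" for i
    unfolding H_def using that V by (intro extension_property_cone) (auto simp: inj_on_def)
  have H_lim: "is_fraisse_limit (hypergraph_lang (Suc k)) (even_hypergraph_class (Suc k)) (H i)"
    and H_dis: "disjoint_amalgamation (hypergraph_lang (Suc k)) (even_hypergraph_class (Suc k))"
    if "i < n" for i
    unfolding hypergraph_lang_eq even_hypergraph_class_eq
    using extension_property.fraisse_limit[OF H[OF that]]
      extension_property.disjoint_amalgamation[OF H[OF that]] by auto
  have "one_point_extension (colored_lang k (2 ^ n)) G (uniform_lang ?J (Suc k)) ?G'"
    using cone_one_point_extension[OF fst(2)] c(1) by simp
  then have "transitive_one_point_extension (colored_lang k (2 ^ n)) G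
      (merge_lang {..<n} (\<lambda>_. hypergraph_lang (k + 1))) ?G'"
    unfolding transitive_one_point_extension_def merge_lang_eq
    using transitive_cone[OF G'.ultrahomogeneous] by simp
  moreover have "is_merge {..<n} (\<lambda>_. hypergraph_lang (k + 1)) H ?G'"
    unfolding is_merge_def
  proof (intro exI[of _ "\<lambda>_. even_hypergraph_class (k + 1)"] conjI ballI)
    show "is_fraisse_limit (merge_lang {..<n} (\<lambda>_. hypergraph_lang (k + 1)))
        (merge_class {..<n} (\<lambda>_. hypergraph_lang (k + 1)) (\<lambda>_. even_hypergraph_class (k + 1))) ?G'"
      using G'.fraisse_limit by (simp add: merge_class_eq merge_lang_eq)
  qed (use H_lim H_dis in auto)
  ultimately show ?thesis
    using H_lim unfolding generic_even_hypergraph_def by auto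
qed

end
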